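(* Given $k\in\mathbb{Z}$, the map sending an oriented minimal perimeter polyomino to the word in the alphabet $\{a,b,a^{-1},b^{-1}\}$ read along its oriented boundary starting from the origin is a bijection between the set of all geodesic representatives of $[a,b]^k$ (that is, geodesic words $w$ with $[w]=[a,b]^k$ in $H(\mathbb{Z})$, with respect to $\{a,b\}$) and the set of all oriented minimal perimeter polyominoes with area $|k|$ whose boundary contains the origin.
   Context: The discrete Heisenberg group is $H(\mathbb{Z}) = \left\{ \begin{pmatrix}1 & n & k \\ 0 & 1 & m\\ 0 & 0 & 1\end{pmatrix} : n,m,k \in \mathbb{Z}\right\}$, with presentation $\langle a,b \mid [[a,b],a]=1,\ [[a,b],b]=1\rangle$, where $a,b$ correspond to $\begin{pmatrix}1 & 1 & 0 \\ 0 & 1 & 0\\ 0 & 0 & 1\end{pmatrix}$ and $\begin{pmatrix}1 & 0 & 0 \\ 0 & 1 & 1\\ 0 & 0 & 1\end{pmatrix}$ respectively, and $[a,b]=aba^{-1}b^{-1}$. Words are words in the alphabet $\{a,b,a^{-1},b^{-1}\}$; $|w|$ is the length of $w$ and $[w]\in H(\mathbb{Z})$ the element it represents. $l(g)$ is the least length of a word representing $g$; a word $w$ is geodesic if $l([w])=|w|$. A polyomino is a connected union of subsets of $\mathbb{R}^2$ of the form $[n,n+1]\times[m,m+1]$, $n,m\in\mathbb{Z}$; its area, boundary and perimeter are defined in the natural way. Given an area $k\in\mathbb{N}$, a polyomino with area $k$ is a minimal perimeter polyomino if it has the lowest possible perimeter among all polyominoes with area $k$. (Any such polyomino is contractible and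 has perimeter $2\lceil 2\sqrt{k}\,\rceil$.) Given a minimal perimeter polyomino whose boundary contains the origin, one can choose an orientation on the boundary and obtain an oriented polyomino. Starting from the origin, one reads a word $w$ along the boundary following the orientation, where $a,a^{-1},b,b^{-1}$ stand for unit steps by $(1,0),(-1,0),(0,1),(0,-1)$ respectively. Since the boundary is a closed polygonal chain, $w$ defines an element of $H(\mathbb{Z})$ of the form $[a,b]^{k}$ with $k\in\mathbb{Z}$; here $|k|$ is the area of the polyomino, and the orientation is positive if and only if $k\ge 0$. *)

theory Defs
  imports "HOL-Analysis.Analysis" "HOL-Algebra.Group"
begin

section \<open>The discrete Heisenberg group\<close>

definition heis_mat :: "int \<Rightarrow> int \<Rightarrow> int \<Rightarrow> int ^ 3 ^ 3" where
  "heis_mat n m k = vector [vector [1, n, k], vector [0, 1, m], vector [0, 0, 1]]"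

definition heisenberg :: "(int ^ 3 ^ 3) monoid" where
  "heisenberg = \<lparr>carrier = {heis_mat n m k | n m k. True}, mult = (**), one = mat 1\<rparr>"

definition gen_a :: "int ^ 3 ^ 3" where "gen_a = heis_mat 1 0 0"
definition gen_b :: "int ^ 3 ^ 3" where "gen_b = heis_mat 0 1 0"

definition commutator :: "('g, 'm) monoid_scheme \<Rightarrow> 'g \<Rightarrow> 'g \<Rightarrow> 'g" where
  "commutator G x y = x \<otimes>\<^bsub>G\<^esub> y \<otimes>\<^bsub>G\<^esub> inv\<^bsub>G\<^esub> x \<otimes>\<^bsub>G\<^esub> inv\<^bsub>G\<^esub> y"

section \<open>Words and geodesics\<close>

datatype letter = A | B | A_inv | B_inv

type_synonym word = "letter list"

fun letter_value :: "letter \<Rightarrow> int ^ 3 ^ 3" where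
  "letter_value A = gen_a"
| "letter_value B = gen_b"
| "letter_value A_inv = inv\<^bsub>heisenberg\<^esub> gen_a"
| "letter_value B_inv = inv\<^bsub>heisenberg\<^esub> gen_b"

fun word_value :: "word \<Rightarrow> int ^ 3 ^ 3" where
  "word_value [] = \<one>\<^bsub>heisenberg\<^esub>"
| "word_value (x # w) = letter_value x \<otimes>\<^bsub>heisenberg\<^esub> word_value w"

definition word_norm :: "int ^ 3 ^ 3 \<Rightarrow> nat" where
  "word_norm g = (LEAST n. \<exists>w. word_value w = g \<and> length w = n)"

definition geodesic_word :: "word \<Rightarrow> bool" where
  "geodesic_word w \<longleftrightarrow> word_norm (word_value w) = length w"

definition geodesic_representatives :: "int ^ 3 ^ 3 \<Rightarrow> word set" where
  "geodesic_representatives g = {w. geodesic_word w \<and> word_value w = g}"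

section \<open>Polyominoes\<close>

definition lattice_point :: "int \<times> int \<Rightarrow> real \<times> real" where
  "lattice_point p = (of_int (fst p), of_int (snd p))"

definition unit_square :: "int \<times> int \<Rightarrow> (real \<times> real) set" where
  "unit_square p =
     {of_int (fst p) .. of_int (fst p) + 1} \<times> {of_int (snd p) .. of_int (snd p) + 1}"

text \<open>
  Finiteness is implicit in speaking of the area \<open>k \<in> \<nat>\<close>; it has to be stated because
  \<^const>\<open>measure\<close> assigns \<open>0\<close> to sets of infinite measure.

  The second disjunct is a convention for area \<open>0\<close>: a degenerate polyomino is a single
  lattice point, which is its own boundary and has perimeter \<open>0\<close>.  It corresponds to the empty
  word, the only geodesic representing the identity.  The empty set could not play this role, since
  its boundary does not contain the origin.
\<close>

definition polyomino :: "(real \<times> real) set \<Rightarrow> bool" where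
  "polyomino P \<longleftrightarrow>
     (\<exists>S. finite S \<and> S \<noteq> {} \<and> P = (\<Union>p\<in>S. unit_square p) \<and> connected P) \<or>
     (\<exists>p. P = {lattice_point p})"

definition area :: "(real \<times> real) set \<Rightarrow> real" where
  "area P = measure lebesgue P"

fun step :: "letter \<Rightarrow> int \<times> int" where
  "step A = (1, 0)"
| "step A_inv = (-1, 0)"
| "step B = (0, 1)"
| "step B_inv = (0, -1)"

text \<open>
  A directed unit edge of the lattice is given by its starting point and its direction;
  \<open>edge_segment\<close> is the underlying undirected edge.
\<close>

definition edge_segment :: "(int \<times> int) \<times> letter \<Rightarrow> (real \<times> real) set" where
  "edge_segment e = closed_segment (lattice_point (fst e)) (lattice_point (fst e + step (snd e)))"

text \<open>
  The boundary of a polyomino is its topological frontier, a union of unit lattice edges; the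
  perimeter is its length, i.e. the number of these edges.
\<close>

definition perimeter :: "(real \<times> real) set \<Rightarrow> nat" where
  "perimeter P = card {s \<in> range edge_segment. s \<subseteq> frontier P}"

definition minimal_perimeter_polyomino :: "(real \<times> real) set \<Rightarrow> bool" where
  "minimal_perimeter_polyomino P \<longleftrightarrow>
     polyomino P \<and> (\<forall>Q. polyomino Q \<and> area Q = area P \<longrightarrow> perimeter P \<le> perimeter Q)"

section \<open>Orientations and reading along the boundary\<close>

text \<open>
  The positive orientation is the counterclockwise one, i.e. the one having the polyomino on the
  left of the boundary.
\<close>

datatype orientation = Positive | Negative

type_synonym oriented_polyomino = "(real \<times> real) set \<times> orientation"

text \<open>The lower left corners of the two unit squares adjacent to a directed edge.\<close>

fun left_square :: "(int \<times> int) \<times> letter \<Rightarrow> int \<times> int" where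
  "left_square (p, A) = p"
| "left_square (p, B) = p - (1, 0)"
| "left_square (p, A_inv) = p - (1, 1)"
| "left_square (p, B_inv) = p - (0, 1)"

fun right_square :: "(int \<times> int) \<times> letter \<Rightarrow> int \<times> int" where
  "right_square (p, A) = p - (0, 1)"
| "right_square (p, B) = p"
| "right_square (p, A_inv) = p - (1, 0)"
| "right_square (p, B_inv) = p - (1, 1)"

fun oriented_boundary_edges :: "oriented_polyomino \<Rightarrow> ((int \<times> int) \<times> letter) set" where
  "oriented_boundary_edges (P, Positive) =
     {e. edge_segment e \<subseteq> frontier P \<and> unit_square (left_square e) \<subseteq> P}"
| "oriented_boundary_edges (P, Negative) =
     {e. edge_segment e \<subseteq> frontier P \<and> unit_square (right_square e) \<subseteq> P}"

text \<open>The directed edges traversed, in order, by the lattice path with step word \<open>w\<close>.\<close>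

fun path_edges :: "int \<times> int \<Rightarrow> word \<Rightarrow> ((int \<times> int) \<times> letter) list" where
  "path_edges p [] = []"
| "path_edges p (x # w) = (p, x) # path_edges (p + step x) w"

text \<open>
  Reading \<open>w\<close> along the oriented boundary from the origin: the lattice path \<open>w\<close> starting at the
  origin is closed and traverses every edge of the boundary exactly once, in the direction given by
  the orientation.
\<close>

definition reads_boundary :: "oriented_polyomino \<Rightarrow> word \<Rightarrow> bool" where
  "reads_boundary Q w \<longleftrightarrow>
     sum_list (map step w) = 0 \<and>
     distinct (path_edges 0 w) \<and>
     set (path_edges 0 w) = oriented_boundary_edges Q"

definition boundary_word :: "oriented_polyomino \<Rightarrow> word" where
  "boundary_word Q = (THE w. reads_boundary Q w)"

text \<open>
  Each polyomino of area \<open>\<bar>k\<bar> > 0\<close> has two orientations, whose words represent \<open>[a,b]\<^sup>k\<close> and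
  \<open>[a,b]\<^sup>-\<^sup>k\<close>; the one belonging to \<open>k\<close> is the positive one if and only if \<open>k \<ge> 0\<close>.
\<close>

definition oriented_minimal_perimeter_polyominoes :: "int \<Rightarrow> oriented_polyomino set" where
  "oriented_minimal_perimeter_polyominoes k =
     {(P, d). minimal_perimeter_polyomino P \<and> area P = of_int \<bar>k\<bar> \<and> 0 \<in> frontier P \<and>
              (d = Positive \<longleftrightarrow> k \<ge> 0)}"

end

theory Submission
  imports Defs
begin

text \<open>
  For a closed lattice path, the winding number \<open>W\<close> of a cell can be computed along a ray to the right,
  from the vertical edges in its row, or along a ray downwards, from the horizontal edges in its column;
  the signed area is the sum of \<open>W\<close> over all cells.  Hence a closed path with \<open>p\<close> steps \<open>a\<close> and
  \<open>q\<close> steps \<open>b\<close> that meets \<open>p'\<close> columns and \<open>q'\<close> rows has area at most \<open>p' q\<close> and \<open>p q'\<close>.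
  Conversely every area up to \<open>p q\<close> is attained by a closed word of length \<open>2 (p + q)\<close>.  A geodesic of
  area \<open>k > 0\<close> therefore crosses every row and column exactly once in each direction, and no row or
  column is without a cell with \<open>W = 1\<close>, as \<open>k\<close> would fit into a smaller box.  This forces
  \<open>W \<in> {0, 1}\<close>, and the path is the boundary of the set of cells with \<open>W = 1\<close>.

  A set of \<open>k\<close> cells meeting \<open>p\<close> columns and \<open>q\<close> rows has perimeter at least \<open>2 (p + q)\<close>, with
  \<open>k \<le> p q\<close>, so minimal perimeters are lengths of geodesics.  For a minimal perimeter polyomino each
  row and column again has exactly two boundary edges, and every closed trail in the boundary is the
  whole boundary, which makes the word read from the origin exist and be unique.
\<close>

section \<open>Words in the Heisenberg group\<close>

lemma heis_mat_mult:
  "heis_mat n m k ** heis_mat n' m' k' = heis_mat (n + n') (m + m') (k + k' + n * m')"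
  by (simp add: heis_mat_def matrix_matrix_mult_def vec_eq_iff forall_3 sum_3 vector_3)

lemma heis_mat_eq_iff [simp]:
  "heis_mat n m k = heis_mat n' m' k' \<longleftrightarrow> n = n' \<and> m = m' \<and> k = k'"
  by (auto simp: heis_mat_def vec_eq_iff forall_3 vector_3)

lemma mat_1_eq_heis_mat: "mat 1 = heis_mat 0 0 0"
  by (simp add: heis_mat_def mat_def vec_eq_iff forall_3 vector_3)

lemma heisenberg_simps [simp]:
  "heis_mat n m k \<in> carrier heisenberg"
  "heis_mat n m k \<otimes>\<^bsub>heisenberg\<^esub> heis_mat n' m' k' = heis_mat (n + n') (m + m') (k + k' + n * m')"
  "\<one>\<^bsub>heisenberg\<^esub> = heis_mat 0 0 0"
  by (auto simp: heisenberg_def heis_mat_mult mat_1_eq_heis_mat)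

lemma group_heisenberg: "group heisenberg"
proof (rule groupI)
  fix x y z
  assume "x \<in> carrier heisenberg" "y \<in> carrier heisenberg" "z \<in> carrier heisenberg"
  then show "x \<otimes>\<^bsub>heisenberg\<^esub> y \<otimes>\<^bsub>heisenberg\<^esub> z = x \<otimes>\<^bsub>heisenberg\<^esub> (y \<otimes>\<^bsub>heisenberg\<^esub> z)"
    by (simp add: heisenberg_def matrix_mul_assoc)
next
  fix x y assume "x \<in> carrier heisenberg" "y \<in> carrier heisenberg"
  then obtain n m k n' m' k' where "x = heis_mat n m k" "y = heis_mat n' m' k'"
    by (auto simp: heisenberg_def)
  then show "x \<otimes>\<^bsub>heisenberg\<^esub> y \<in> carrier heisenberg" by simp
next
  fix x assume "x \<in> carrier heisenberg"
  then obtain n m k where x: "x = heis_mat n m k"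
    by (auto simp: heisenberg_def)
  show "\<one>\<^bsub>heisenberg\<^esub> \<otimes>\<^bsub>heisenberg\<^esub> x = x" by (simp add: x)
  show "\<exists>y\<in>carrier heisenberg. y \<otimes>\<^bsub>heisenberg\<^esub> x = \<one>\<^bsub>heisenberg\<^esub>"
    by (rule bexI[where x = "heis_mat (- n) (- m) (n * m - k)"]) (simp_all add: x)
qed simp

interpretation heisenberg: group heisenberg
  by (rule group_heisenberg)

lemma inv_heis_mat [simp]: "inv\<^bsub>heisenberg\<^esub> heis_mat n m k = heis_mat (- n) (- m) (n * m - k)"
  by (rule heisenberg.inv_equality) simp_all

text \<open>The commutator is the central matrix \<open>heis_mat 0 0 1\<close>, so taking powers
  only scales the corner entry.\<close>

lemma commutator_power:
  "commutator heisenberg gen_a gen_b [^]\<^bsub>heisenberg\<^esub> (k::int) = heis_mat 0 0 k"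
proof -
  have c: "commutator heisenberg gen_a gen_b = heis_mat 0 0 1"
    by (simp add: commutator_def gen_a_def gen_b_def)
  have nat: "heis_mat 0 0 1 [^]\<^bsub>heisenberg\<^esub> (n::nat) = heis_mat 0 0 (int n)" for n
    by (induction n) (simp_all add: heisenberg.nat_pow_Suc)
  show ?thesis
    by (cases k) (simp_all add: c nat int_pow_int heisenberg.int_pow_neg_int del: of_nat_Suc)
qed

lemma letter_value_eq: "letter_value x = heis_mat (fst (step x)) (snd (step x)) 0"
  by (cases x) (simp_all add: gen_a_def gen_b_def)

abbreviation displacement :: "word \<Rightarrow> int \<times> int" where
  "displacement w \<equiv> sum_list (map step w)"

text \<open>The line integral of x dy along the path; by Green's formula it is the enclosed area
  when the path is closed.\<close>

definition signed_area :: "int \<times> int \<Rightarrow> word \<Rightarrow> int" where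
  "signed_area p w = (\<Sum>e\<leftarrow>path_edges p w. fst (fst e) * snd (step (snd e)))"

lemma signed_area_shift:
  "signed_area (p + d) w = signed_area p w + fst d * snd (displacement w)"
proof (induction w arbitrary: p)
  case (Cons x w)
  from Cons.IH[of "p + step x"] show ?case
    by (simp add: signed_area_def algebra_simps)
qed (simp add: signed_area_def)

text \<open>Multiplying by a letter on the left adds its horizontal step times the total rise of the
  rest to the corner entry, which is exactly what translating the rest by that step does to x
  dy.\<close>

lemma word_value_eq:
  "word_value w = heis_mat (fst (displacement w)) (snd (displacement w)) (signed_area 0 w)"
proof (induction w)
  case (Cons x w)
  then show ?case
    using signed_area_shift[of 0 "step x" w] by (simp add: letter_value_eq signed_area_def)
qed (simp add: signed_area_def)

lemma geodesic_word_iff: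
  "geodesic_word w \<longleftrightarrow> (\<forall>w'. word_value w' = word_value w \<longrightarrow> length w \<le> length w')"
proof -
  let ?P = "\<lambda>n. \<exists>w'. word_value w' = word_value w \<and> length w' = n"
  have "?P (length w)" by blast
  then have "?P (word_norm (word_value w))" and "\<And>n. ?P n \<Longrightarrow> word_norm (word_value w) \<le> n"
    unfolding word_norm_def by (rule LeastI, simp add: Least_le)
  then show ?thesis
    unfolding geodesic_word_def by (metis le_antisym)
qed

text \<open>This turns the group-theoretic question into an isoperimetric one: shortest closed
  lattice paths of prescribed signed area.\<close>

lemma geodesic_representatives_iff:
  "w \<in> geodesic_representatives (heis_mat 0 0 k) \<longleftrightarrow>
     displacement w = 0 \<and> signed_area 0 w = k \<and>
     (\<forall>w'. displacement w' = 0 \<and> signed_area 0 w' = k \<longrightarrow> length w \<le> length w')"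
  by (auto simp: geodesic_representatives_def geodesic_word_iff word_value_eq prod_eq_iff)

section \<open>Lattice paths\<close>

lemma path_edges_append [simp]:
  "path_edges p (u @ v) = path_edges p u @ path_edges (p + displacement u) v"
  by (induction u arbitrary: p) (simp_all add: add.assoc)

lemma length_path_edges [simp]: "length (path_edges p w) = length w"
  by (induction w arbitrary: p) simp_all

lemma path_edges_eq_Nil_iff [simp]: "path_edges p w = [] \<longleftrightarrow> w = []"
  by (cases w) simp_all

lemma signed_area_append:
  "signed_area p (u @ v) = signed_area p u + signed_area (p + displacement u) v"
  by (simp add: signed_area_def)

lemma signed_area_Cons:
  "signed_area p (x # w) = fst p * snd (step x) + signed_area (p + step x) w"
  by (simp add: signed_area_def)

lemma path_edges_split:
  assumes "e \<in> set (path_edges p w)"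
  shows "\<exists>u v. w = u @ snd e # v \<and> p + displacement u = fst e"
  using assms
proof (induction w arbitrary: p)
  case (Cons x w)
  show ?case
  proof (cases "e = (p, x)")
    case True
    then show ?thesis by (intro exI[of _ "[]"] exI[of _ w]) simp
  next
    case False
    with Cons.prems have "e \<in> set (path_edges (p + step x) w)" by simp
    from Cons.IH[OF this] obtain u v
      where "w = u @ snd e # v" "p + step x + displacement u = fst e" by blast
    then show ?thesis by (intro exI[of _ "x # u"] exI[of _ v]) (simp add: add.assoc)
  qed
qed simp

text \<open>An edge function that is the increment of a potential sums to zero over a closed path;
  the balance of crossings and the comparison of rays rest on this.\<close>

lemma sum_path_edges_telescope:
  fixes f :: "int \<times> int \<Rightarrow> 'a::ab_group_add"
  assumes "\<And>p x. g (p, x) = f (p + step x) - f p"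
  shows "(\<Sum>e\<leftarrow>path_edges p w. g e) = f (p + displacement w) - f p"
  by (induction w arbitrary: p) (simp_all add: assms add.assoc)

section \<open>Reversing edges and words\<close>

fun flip_letter :: "letter \<Rightarrow> letter" where
  "flip_letter A = A_inv"
| "flip_letter A_inv = A"
| "flip_letter B = B_inv"
| "flip_letter B_inv = B"

fun flip_edge :: "(int \<times> int) \<times> letter \<Rightarrow> (int \<times> int) \<times> letter" where
  "flip_edge (p, x) = (p + step x, flip_letter x)"

lemma step_flip_letter [simp]: "step (flip_letter x) = - step x"
  by (cases x) simp_all

lemma flip_letter_flip_letter [simp]: "flip_letter (flip_letter x) = x"
  by (cases x) simp_all

lemma flip_edge_flip_edge [simp]: "flip_edge (flip_edge e) = e"
  by (cases e) simp

lemma left_square_flip_edge [simp]: "left_square (flip_edge e) = right_square e"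
  by (cases e; cases "snd e") auto

lemma right_square_flip_edge [simp]: "right_square (flip_edge e) = left_square e"
  by (metis flip_edge_flip_edge left_square_flip_edge)

lemma edge_segment_flip_edge [simp]: "edge_segment (flip_edge e) = edge_segment e"
  by (cases e) (simp add: edge_segment_def closed_segment_commute)

definition reverse_word :: "word \<Rightarrow> word" where
  "reverse_word w = rev (map flip_letter w)"

lemma reverse_word_reverse_word [simp]: "reverse_word (reverse_word w) = w"
  by (simp add: reverse_word_def rev_map comp_def)

lemma length_reverse_word [simp]: "length (reverse_word w) = length w"
  by (simp add: reverse_word_def)

lemma displacement_reverse_word [simp]: "displacement (reverse_word w) = - displacement w"
  by (induction w) (simp_all add: reverse_word_def)

lemma path_edges_reverse_word:
  "path_edges (p + displacement w) (reverse_word w) = rev (map flip_edge (path_edges p w))"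
proof (induction w arbitrary: p)
  case (Cons x w)
  have "path_edges (p + displacement (x # w)) (reverse_word (x # w)) =
        path_edges ((p + step x) + displacement w) (reverse_word w) @
        [(p + step x, flip_letter x)]"
    using displacement_reverse_word[of w]
    by (simp add: reverse_word_def add.assoc)
  then show ?case by (simp only: Cons.IH) simp
qed (simp add: reverse_word_def)

text \<open>Closedness makes the reversed path start at the same point. A flipped vertical edge
  keeps its abscissa and negates its rise; horizontal edges contribute nothing.\<close>

lemma signed_area_reverse_word:
  assumes "displacement w = 0"
  shows "signed_area p (reverse_word w) = - signed_area p w"
proof -
  have "signed_area p (reverse_word w) =
        (\<Sum>e\<leftarrow>path_edges p w. fst (fst (flip_edge e)) * snd (step (snd (flip_edge e))))"
    using path_edges_reverse_word[of p w] assms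
    by (simp add: signed_area_def rev_map[symmetric] sum_list_rev comp_def)
  also have "\<dots> = (\<Sum>e\<leftarrow>path_edges p w. - (fst (fst e) * snd (step (snd e))))"
  proof (rule arg_cong[where f = sum_list], rule map_cong[OF refl])
    fix e :: "(int \<times> int) \<times> letter"
    show "fst (fst (flip_edge e)) * snd (step (snd (flip_edge e))) =
          - (fst (fst e) * snd (step (snd e)))"
      by (cases e; cases "snd e") auto
  qed
  also have "\<dots> = - signed_area p w"
    by (simp add: signed_area_def uminus_sum_list_map comp_def)
  finally show ?thesis .
qed

text \<open>Reversal is a length-preserving involution that negates the area of closed words; it
  reduces negative areas to positive ones.\<close>

lemma geodesic_representatives_reverse_word:
  "reverse_word w \<in> geodesic_representatives (heis_mat 0 0 k) \<longleftrightarrow>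
   w \<in> geodesic_representatives (heis_mat 0 0 (- k))"
proof -
  have *: "reverse_word w \<in> geodesic_representatives (heis_mat 0 0 k)"
    if "w \<in> geodesic_representatives (heis_mat 0 0 (- k))" for w k
    unfolding geodesic_representatives_iff
  proof (intro conjI allI impI)
    from that show "displacement (reverse_word w) = 0" "signed_area 0 (reverse_word w) = k"
      by (simp_all add: geodesic_representatives_iff signed_area_reverse_word)
    fix w' assume "displacement w' = 0 \<and> signed_area 0 w' = k"
    then have "displacement (reverse_word w') = 0 \<and> signed_area 0 (reverse_word w') = - k"
      by (simp add: signed_area_reverse_word)
    with that have "length w \<le> length (reverse_word w')"
      unfolding geodesic_representatives_iff by blast
    then show "length (reverse_word w) \<le> length w'" by simp
  qed
  from *[of w k] *[of "reverse_word w" "- k"] show ?thesis by auto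
qed

section \<open>Short closed words of prescribed area\<close>

lemma sum_list_replicate_pair:
  "sum_list (replicate n (a :: int, b :: int)) = (int n * a, int n * b)"
  by (induction n) (simp_all add: prod_eq_iff algebra_simps)

lemma signed_area_replicate:
  "signed_area p (replicate n A) = 0"
  "signed_area p (replicate n A_inv) = 0"
  "signed_area p (replicate n B) = int n * fst p"
  "signed_area p (replicate n B_inv) = - (int n * fst p)"
  by (induction n arbitrary: p) (simp_all add: signed_area_def algebra_simps)

text \<open>The area counted lies between the path and the vertical axis. In the induction on
  \<open>q\<close>, a small \<open>k\<close> is handled by an initial \<open>B\<close> step at
  abscissa 0, which adds nothing.\<close>

lemma ex_staircase:
  assumes "k \<le> p * q"
  shows "\<exists>w. displacement w = (int p, int q) \<and> length w = p + q \<and> signed_area 0 w = int k"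
  using assms
proof (induction q arbitrary: k)
  case 0
  then show ?case
    by (intro exI[of _ "replicate p A"])
      (simp add: sum_list_replicate_pair signed_area_replicate)
next
  case (Suc q)
  show ?case
  proof (cases "k \<le> p * q")
    case True
    then obtain w where w: "displacement w = (int p, int q)" "length w = p + q"
        "signed_area 0 w = int k"
      using Suc.IH by blast
    show ?thesis
      using w signed_area_shift[of 0 "(0, 1)" w]
      by (intro exI[of _ "B # w"]) (simp add: signed_area_Cons)
  next
    case False
    define r where "r = k - p * q"
    have r: "k = p * q + r" "r \<le> p"
      using False Suc.prems by (auto simp: r_def)
    show ?thesis
      \<comment> \<open>The \<open>B\<close> step at abscissa \<open>r\<close> contributes
        \<open>r\<close>, and the final \<open>q\<close> steps at abscissa \<open>p\<close>
        contribute \<open>p * q\<close>.\<close>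
      using r by (intro exI[of _ "replicate r A @ B # replicate (p - r) A @ replicate q B"])
        (simp add: sum_list_replicate_pair signed_area_replicate signed_area_append
          signed_area_Cons of_nat_diff)
  qed
qed

lemma ex_closed_word:
  assumes "k \<le> p * q"
  shows "\<exists>w. displacement w = 0 \<and> length w = 2 * (p + q) \<and> signed_area 0 w = int k"
proof -
  obtain w where "displacement w = (int p, int q)" "length w = p + q" "signed_area 0 w = int k"
    using ex_staircase[OF assms] by blast
  then show ?thesis
    \<comment> \<open>The way back adds no area: first come horizontal steps, then a descent at
      abscissa 0.\<close>
    by (intro exI[of _ "w @ replicate p A_inv @ replicate q B_inv"])
      (simp add: sum_list_replicate_pair signed_area_replicate signed_area_append zero_prod_def)
qed

section \<open>Winding numbers of closed lattice paths\<close>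

text \<open>The signed contribution of an edge to the ray running right from the centre of the cell.
  A \<open>B_inv\<close> edge starts at its upper end, hence \<open>y + 1\<close>.\<close>

fun ray_right :: "int \<times> int \<Rightarrow> (int \<times> int) \<times> letter \<Rightarrow> int" where
  "ray_right (x, y) ((u, v), B) = of_bool (v = y \<and> x < u)"
| "ray_right (x, y) ((u, v), B_inv) = - of_bool (v = y + 1 \<and> x < u)"
| "ray_right c (p, A) = 0"
| "ray_right c (p, A_inv) = 0"

fun ray_down :: "int \<times> int \<Rightarrow> (int \<times> int) \<times> letter \<Rightarrow> int" where
  "ray_down (x, y) ((u, v), A) = of_bool (u = x \<and> v \<le> y)"
| "ray_down (x, y) ((u, v), A_inv) = - of_bool (u = x + 1 \<and> v \<le> y)"
| "ray_down c (p, B) = 0"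
| "ray_down c (p, B_inv) = 0"

definition winding :: "int \<times> int \<Rightarrow> word \<Rightarrow> int \<times> int \<Rightarrow> int" where
  "winding p w c = (\<Sum>e\<leftarrow>path_edges p w. ray_right c e)"

text \<open>The two rays bound a quadrant. The difference of their contributions is, up to sign, the
  increment of its indicator and telescopes away on a closed path.\<close>

lemma winding_eq_ray_down:
  assumes "displacement w = 0"
  shows "winding p w c = (\<Sum>e\<leftarrow>path_edges p w. ray_down c e)"
proof -
  obtain x y where c: "c = (x, y)" by (cases c)
  define f :: "int \<times> int \<Rightarrow> int" where "f v = - of_bool (fst v > x \<and> snd v \<le> y)" for v
  have "ray_right c (p, l) - ray_down c (p, l) = f (p + step l) - f p" for p l
    by (cases p; cases l) (auto simp: f_def c)
  from sum_path_edges_telescope[of "\<lambda>e. ray_right c e - ray_down c e" f p w, OF this] assms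
  show ?thesis by (simp add: winding_def sum_list_subtractf)
qed

text \<open>The direction of an edge together with the column or row it traverses. Edges in an
  inverse direction start at their right or upper end, hence the shift by 1.\<close>

fun crossing :: "(int \<times> int) \<times> letter \<Rightarrow> letter \<times> int" where
  "crossing ((u, v), A) = (A, u)"
| "crossing ((u, v), A_inv) = (A_inv, u - 1)"
| "crossing ((u, v), B) = (B, v)"
| "crossing ((u, v), B_inv) = (B_inv, v - 1)"

lemma fst_crossing [simp]: "fst (crossing e) = snd e"
  by (cases e rule: crossing.cases) simp_all

lemma crossing_eq_iff:
  "crossing e = (A, x) \<longleftrightarrow> (\<exists>y. e = ((x, y), A))"
  "crossing e = (A_inv, x) \<longleftrightarrow> (\<exists>y. e = ((x + 1, y), A_inv))"
  "crossing e = (B, y) \<longleftrightarrow> (\<exists>x. e = ((x, y), B))"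
  "crossing e = (B_inv, y) \<longleftrightarrow> (\<exists>x. e = ((x, y + 1), B_inv))"
  by (cases e rule: crossing.cases; auto)+

abbreviation crossings :: "int \<times> int \<Rightarrow> word \<Rightarrow> (letter \<times> int) list" where
  "crossings p w \<equiv> map crossing (path_edges p w)"

definition path_columns :: "int \<times> int \<Rightarrow> word \<Rightarrow> int set" where
  "path_columns p w = {x. (A, x) \<in> set (crossings p w)}"

definition path_rows :: "int \<times> int \<Rightarrow> word \<Rightarrow> int set" where
  "path_rows p w = {y. (B, y) \<in> set (crossings p w)}"

text \<open>The crossing pattern shared by closed paths and boundaries of finite cell sets: every
  column and row in both directions.\<close>

definition box_crossings :: "int set \<Rightarrow> int set \<Rightarrow> (letter \<times> int) set" where
  "box_crossings X Y = {A, A_inv} \<times> X \<union> {B, B_inv} \<times> Y"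

lemma card_box_crossings:
  assumes "finite X" "finite Y"
  shows "card (box_crossings X Y) = 2 * (card X + card Y)"
  unfolding box_crossings_def using assms
  by (subst card_Un_disjoint) (auto simp: card_cartesian_product)

lemma finite_path_columns [simp]: "finite (path_columns p w)"
proof -
  have "Pair A ` path_columns p w \<subseteq> set (crossings p w)" by (auto simp: path_columns_def)
  then show ?thesis by (meson List.finite_set finite_imageD finite_subset inj_on_def prod.inject)
qed

lemma finite_path_rows [simp]: "finite (path_rows p w)"
proof -
  have "Pair B ` path_rows p w \<subseteq> set (crossings p w)" by (auto simp: path_rows_def)
  then show ?thesis by (meson List.finite_set finite_imageD finite_subset inj_on_def prod.inject)
qed

lemma count_list_map_eq: "int (count_list (map f xs) t) = (\<Sum>x\<leftarrow>xs. of_bool (f x = t))"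
  by (induction xs) auto

lemma count_list_eq: "int (count_list xs t) = (\<Sum>x\<leftarrow>xs. of_bool (x = t))"
  using count_list_map_eq[of "\<lambda>x. x" xs t] by simp

text \<open>Edges in column \<open>x\<close> are the ones that enter or leave the half-plane to its
  right, and a closed path enters as often as it leaves; similarly for rows.\<close>

lemma count_crossings_balanced:
  assumes "displacement w = 0"
  shows "count_list (crossings p w) (A, x) = count_list (crossings p w) (A_inv, x)"
    and "count_list (crossings p w) (B, y) = count_list (crossings p w) (B_inv, y)"
proof -
  define f g :: "int \<times> int \<Rightarrow> int"
    where "f v = of_bool (fst v > x)" and "g v = of_bool (snd v > y)" for v
  have f: "of_bool (crossing (p, l) = (A, x)) - of_bool (crossing (p, l) = (A_inv, x)) =
      f (p + step l) - f p" for p l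
    by (cases p; cases l) (auto simp: f_def)
  have g: "of_bool (crossing (p, l) = (B, y)) - of_bool (crossing (p, l) = (B_inv, y)) =
      g (p + step l) - g p" for p l
    by (cases p; cases l) (auto simp: g_def)
  from sum_path_edges_telescope[OF f, of p w] assms
  have "int (count_list (crossings p w) (A, x)) = int (count_list (crossings p w) (A_inv, x))"
    by (simp add: count_list_map_eq sum_list_subtractf)
  then show "count_list (crossings p w) (A, x) = count_list (crossings p w) (A_inv, x)"
    by simp
  from sum_path_edges_telescope[OF g, of p w] assms
  have "int (count_list (crossings p w) (B, y)) = int (count_list (crossings p w) (B_inv, y))"
    by (simp add: count_list_map_eq sum_list_subtractf)
  then show "count_list (crossings p w) (B, y) = count_list (crossings p w) (B_inv, y)"
    by simp
qed

lemma set_crossings: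
  assumes "displacement w = 0"
  shows "set (crossings p w) = box_crossings (path_columns p w) (path_rows p w)"
proof -
  have *: "(A_inv, x) \<in> set (crossings p w) \<longleftrightarrow> (A, x) \<in> set (crossings p w)"
    "(B_inv, x) \<in> set (crossings p w) \<longleftrightarrow> (B, x) \<in> set (crossings p w)" for x
    using count_crossings_balanced[OF assms, of p x] by (metis count_list_0_iff)+
  have "t \<in> set (crossings p w) \<longleftrightarrow> t \<in> box_crossings (path_columns p w) (path_rows p w)" for t
    using *[of "snd t"]
    by (cases t; cases "fst t") (auto simp: box_crossings_def path_columns_def path_rows_def)
  then show ?thesis by blast
qed

text \<open>The rays to the right from the two sides of a vertical edge differ in this edge only,
  and so do the downward rays for a horizontal edge. The winding number thus jumps by the net number
  of passages.\<close>

lemma winding_diff: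
  assumes "displacement w = 0"
  shows "winding p w (left_square e) - winding p w (right_square e) =
    int (count_list (path_edges p w) e) - int (count_list (path_edges p w) (flip_edge e))"
proof -
  have up: "winding p w (x - 1, y) - winding p w (x, y) =
      int (count_list (path_edges p w) ((x, y), B)) -
      int (count_list (path_edges p w) ((x, y + 1), B_inv))" for x y
  proof -
    have "ray_right (x - 1, y) e - ray_right (x, y) e =
        of_bool (e = ((x, y), B)) - of_bool (e = ((x, y + 1), B_inv))" for e
      by (cases e rule: crossing.cases) auto
    then show ?thesis
      by (simp add: winding_def count_list_eq flip: sum_list_subtractf)
  qed
  have right: "winding p w (x, y) - winding p w (x, y - 1) =
      int (count_list (path_edges p w) ((x, y), A)) -
      int (count_list (path_edges p w) ((x + 1, y), A_inv))" for x y
  proof -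
    have "ray_down (x, y) e - ray_down (x, y - 1) e =
        of_bool (e = ((x, y), A)) - of_bool (e = ((x + 1, y), A_inv))" for e
      by (cases e rule: crossing.cases) auto
    then show ?thesis
      by (simp add: winding_eq_ray_down[OF assms] count_list_eq flip: sum_list_subtractf)
  qed
  obtain u v l where e: "e = ((u, v), l)" by (cases e) auto
  show ?thesis
    using up[of u v] up[of u "v - 1"] right[of u v] right[of "u - 1" v]
    by (cases l) (simp_all add: e)
qed

text \<open>Positive contributions come only from \<open>B\<close> edges in the row for the ray to
  the right, and only from \<open>A\<close> edges in the column for the downward ray.\<close>

lemma winding_le_count:
  shows "winding p w (x, y) \<le> int (count_list (crossings p w) (B, y))"
    and "displacement w = 0 \<Longrightarrow> winding p w (x, y) \<le> int (count_list (crossings p w) (A, x))"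
proof -
  have "ray_right (x, y) e \<le> of_bool (crossing e = (B, y))" for e
    by (cases e rule: crossing.cases) auto
  then show "winding p w (x, y) \<le> int (count_list (crossings p w) (B, y))"
    unfolding winding_def count_list_map_eq by (intro sum_list_mono) auto
  assume "displacement w = 0"
  have "ray_down (x, y) e \<le> of_bool (crossing e = (A, x))" for e
    by (cases e rule: crossing.cases) auto
  then show "winding p w (x, y) \<le> int (count_list (crossings p w) (A, x))"
    unfolding winding_eq_ray_down[OF \<open>displacement w = 0\<close>] count_list_map_eq
    by (intro sum_list_mono) auto
qed

lemma winding_support:
  assumes w: "displacement w = 0" and nz: "winding p w (x, y) \<noteq> 0"
  shows "x \<in> path_columns p w" and "y \<in> path_rows p w"
proof -
  have "\<exists>e\<in>set (path_edges p w). ray_right (x, y) e \<noteq> 0"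
    using nz unfolding winding_def by (metis (no_types, lifting) map_cong sum_list_0)
  then obtain e where e: "e \<in> set (path_edges p w)" "ray_right (x, y) e \<noteq> 0" by blast
  then have "crossing e \<in> {(B, y), (B_inv, y)}"
    by (cases e rule: crossing.cases) (auto split: if_splits)
  moreover have "crossing e \<in> box_crossings (path_columns p w) (path_rows p w)"
    using e(1) set_crossings[OF w, of p] by auto
  ultimately show "y \<in> path_rows p w" by (auto simp: box_crossings_def)
  have "\<exists>e\<in>set (path_edges p w). ray_down (x, y) e \<noteq> 0"
    using nz unfolding winding_eq_ray_down[OF w] by (metis (no_types, lifting) map_cong sum_list_0)
  then obtain e where e: "e \<in> set (path_edges p w)" "ray_down (x, y) e \<noteq> 0" by blast
  then have "crossing e \<in> {(A, x), (A_inv, x)}"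
    by (cases e rule: crossing.cases) (auto split: if_splits)
  moreover have "crossing e \<in> box_crossings (path_columns p w) (path_rows p w)"
    using e(1) set_crossings[OF w, of p] by auto
  ultimately show "x \<in> path_columns p w" by (auto simp: box_crossings_def)
qed

lemma finite_winding_support:
  assumes "displacement w = 0"
  shows "finite {c. winding p w c \<noteq> 0}"
proof (rule finite_subset)
  show "{c. winding p w c \<noteq> 0} \<subseteq> path_columns p w \<times> path_rows p w"
    using winding_support[OF assms, of p] by auto
qed simp

text \<open>A vertical edge at abscissa \<open>u\<close> is seen by exactly the cells to its left in
  its row, of which the box contains \<open>u + N\<close>.\<close>

lemma sum_ray_right:
  assumes "\<bar>fst (fst e)\<bar> < N" "\<bar>snd (fst e)\<bar> < N"
  shows "(\<Sum>c\<in>{-N..<N} \<times> {-N..<N}. ray_right c e) = (fst (fst e) + N) * snd (step (snd e))"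
proof -
  obtain u v l where e: "e = ((u, v), l)" by (cases e) auto
  have uv: "\<bar>u\<bar> < N" "\<bar>v\<bar> < N" using assms by (auto simp: e)
  have *: "(\<Sum>c\<in>{-N..<N} \<times> {-N..<N}. of_bool (t = snd c \<and> fst c < u) :: int) = u + N"
    if "-N \<le> t" "t < N" for t
  proof -
    have "({-N..<N} \<times> {-N..<N}) \<inter> {c. t = snd c \<and> fst c < u} = {-N..<u} \<times> {t}"
      using that uv by auto
    then show ?thesis using uv by (simp add: sum_of_bool_eq)
  qed
  consider "l = B" | "l = B_inv" | "l = A \<or> l = A_inv" by (cases l) auto
  then show ?thesis
  proof cases
    case 1
    then have "ray_right c e = of_bool (v = snd c \<and> fst c < u)" for c
      by (cases c) (simp add: e)
    then show ?thesis using 1 * uv by (simp add: e)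
  next
    case 2
    then have "ray_right c e = - of_bool (v - 1 = snd c \<and> fst c < u)" for c
      by (cases c) (auto simp: e)
    then show ?thesis using 2 *[of "v - 1"] uv by (simp add: e sum_negf)
  next
    case 3
    then have "ray_right c e = 0" for c by (auto simp: e)
    then show ?thesis using 3 by (auto simp: e)
  qed
qed

lemma sum_sum_list_swap:
  "(\<Sum>c\<in>C. \<Sum>e\<leftarrow>es. f c e) = (\<Sum>e\<leftarrow>es. \<Sum>c\<in>C. f c e :: 'a::comm_monoid_add)"
  by (induction es) (simp_all add: sum.distrib)

text \<open>A discrete Green formula, obtained by exchanging the sums over cells and over
  edges.\<close>

lemma signed_area_eq_sum_winding:
  assumes w: "displacement w = 0"
  shows "signed_area p w = (\<Sum>c\<in>path_columns p w \<times> path_rows p w. winding p w c)"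
proof -
  \<comment> \<open>A box size exceeding the absolute values of all coordinates at which an edge
    starts.\<close>
  define N where "N = (\<Sum>e\<leftarrow>path_edges p w. \<bar>fst (fst e)\<bar> + \<bar>snd (fst e)\<bar>) + 1"
  have N: "\<bar>fst (fst e)\<bar> < N \<and> \<bar>snd (fst e)\<bar> < N" if "e \<in> set (path_edges p w)" for e
  proof -
    have "\<bar>fst (fst e)\<bar> + \<bar>snd (fst e)\<bar> \<le>
        (\<Sum>e\<leftarrow>path_edges p w. \<bar>fst (fst e)\<bar> + \<bar>snd (fst e)\<bar>)"
      using that by (intro member_le_sum_list) auto
    then show ?thesis
      using abs_ge_zero[of "fst (fst e)"] abs_ge_zero[of "snd (fst e)"] unfolding N_def by linarith
  qed
  let ?C = "{-N..<N} \<times> {-N..<N}"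
  have "(\<Sum>c\<in>?C. winding p w c) =
        (\<Sum>e\<leftarrow>path_edges p w. (fst (fst e) + N) * snd (step (snd e)))"
    unfolding winding_def sum_sum_list_swap
    by (intro arg_cong[where f = sum_list] map_cong refl sum_ray_right) (use N in auto)
  also have "\<dots> = signed_area p w + N * (\<Sum>e\<leftarrow>path_edges p w. snd (step (snd e)))"
    by (simp add: signed_area_def distrib_right sum_list_addf sum_list_const_mult)
  \<comment> \<open>Measuring abscissas from the left side of the box adds \<open>N\<close> times
    the total rise, which is zero for a closed path.\<close>
  also have "(\<Sum>e\<leftarrow>path_edges p w. snd (step (snd e))) = 0"
    using sum_path_edges_telescope[of "\<lambda>e. snd (step (snd e))" snd p w] w by simp
  finally have "(\<Sum>c\<in>?C. winding p w c) = signed_area p w" by simp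
  moreover have "(\<Sum>c\<in>?C. winding p w c) = (\<Sum>c\<in>path_columns p w \<times> path_rows p w. winding p w c)"
  proof (rule sum.mono_neutral_right)
    have "x \<in> {-N..<N}" if "x \<in> path_columns p w \<union> path_rows p w" for x
    proof -
      from that obtain e where "e \<in> set (path_edges p w)" "crossing e \<in> {(A, x), (B, x)}"
        by (auto simp: path_columns_def path_rows_def)
      with N[of e] show ?thesis by (auto simp: crossing_eq_iff)
    qed
    then show "path_columns p w \<times> path_rows p w \<subseteq> ?C" by blast
    show "\<forall>c\<in>?C - path_columns p w \<times> path_rows p w. winding p w c = 0"
      using winding_support[OF w, of p] by fastforce
  qed simp
  ultimately show ?thesis by simp
qed

section \<open>The isoperimetric inequality\<close>

lemma sum_count_crossings:
  assumes "finite X"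
  shows "(\<Sum>x\<in>X. count_list (crossings p w) (l, x)) \<le> count_list w l"
proof (induction w arbitrary: p)
  case (Cons a w)
  have "(\<Sum>x\<in>X. of_bool (t = (l, x)) :: nat) \<le> of_bool (fst t = l)" for t
    using assms by (cases t) (auto simp: sum_of_bool_eq if_distrib card_le_Suc0_iff_eq)
  note this[of "crossing (p, a)"]
  moreover have "(\<Sum>x\<in>X. count_list (crossings p (a # w)) (l, x)) =
      (\<Sum>x\<in>X. of_bool (crossing (p, a) = (l, x))) +
      (\<Sum>x\<in>X. count_list (crossings (p + step a) w) (l, x))"
    by (simp flip: sum.distrib) (intro sum.cong, auto)
  ultimately show ?case using Cons.IH[of "p + step a"] by (auto split: if_splits)
qed simp

lemma card_path_columns_le: "card (path_columns p w) \<le> count_list w A"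
proof -
  have "card (path_columns p w) = (\<Sum>x\<in>path_columns p w. 1)" by simp
  also have "\<dots> \<le> (\<Sum>x\<in>path_columns p w. count_list (crossings p w) (A, x))"
    by (intro sum_mono) (auto simp: path_columns_def Suc_le_eq count_list_0_iff simp flip: neq0_conv)
  also have "\<dots> \<le> count_list w A" by (rule sum_count_crossings) simp
  finally show ?thesis .
qed

lemma card_path_rows_le: "card (path_rows p w) \<le> count_list w B"
proof -
  have "card (path_rows p w) = (\<Sum>x\<in>path_rows p w. 1)" by simp
  also have "\<dots> \<le> (\<Sum>x\<in>path_rows p w. count_list (crossings p w) (B, x))"
    by (intro sum_mono) (auto simp: path_rows_def Suc_le_eq count_list_0_iff simp flip: neq0_conv)
  also have "\<dots> \<le> count_list w B" by (rule sum_count_crossings) simp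
  finally show ?thesis .
qed

lemma length_closed_word:
  assumes "displacement w = 0"
  shows "length w = 2 * (count_list w A + count_list w B)"
proof -
  have "displacement w = (int (count_list w A) - int (count_list w A_inv),
      int (count_list w B) - int (count_list w B_inv))"
  proof (induction w)
    case (Cons x w)
    then show ?case by (cases x) auto
  qed (simp add: zero_prod_def)
  moreover have "length w =
      count_list w A + count_list w A_inv + count_list w B + count_list w B_inv"
  proof (induction w)
    case (Cons x w)
    then show ?case by (cases x) auto
  qed simp
  ultimately show ?thesis using assms by (simp add: zero_prod_def)
qed

text \<open>The bound on the winding number depends only on the row, so each row count is repeated
  once per visited column; likewise with the roles exchanged. Mixing visited columns with
  \<open>B\<close> steps, and visited rows with \<open>A\<close> steps, later forces a geodesic to
  have as many steps as visited columns and rows.\<close>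

lemma signed_area_le:
  assumes w: "displacement w = 0"
  shows "signed_area p w \<le> int (card (path_columns p w) * count_list w B)"
    and "signed_area p w \<le> int (count_list w A * card (path_rows p w))"
proof -
  have "signed_area p w \<le>
      (\<Sum>(x, y)\<in>path_columns p w \<times> path_rows p w. int (count_list (crossings p w) (B, y)))"
    unfolding signed_area_eq_sum_winding[OF w]
    by (intro sum_mono) (auto intro: winding_le_count)
  also have "\<dots> = int (card (path_columns p w) * (\<Sum>y\<in>path_rows p w. count_list (crossings p w) (B, y)))"
    by (simp flip: sum.cartesian_product)
  also have "\<dots> \<le> int (card (path_columns p w) * count_list w B)"
    by (intro of_nat_mono mult_left_mono sum_count_crossings) auto
  finally show "signed_area p w \<le> int (card (path_columns p w) * count_list w B)" .
  have "signed_area p w \<le>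
      (\<Sum>(x, y)\<in>path_columns p w \<times> path_rows p w. int (count_list (crossings p w) (A, x)))"
    unfolding signed_area_eq_sum_winding[OF w]
    by (intro sum_mono) (auto intro: winding_le_count w)
  also have "\<dots> = int ((\<Sum>x\<in>path_columns p w. count_list (crossings p w) (A, x)) * card (path_rows p w))"
    by (simp flip: sum.cartesian_product add: sum_distrib_left mult.commute)
  also have "\<dots> \<le> int (count_list w A * card (path_rows p w))"
    by (intro of_nat_mono mult_right_mono sum_count_crossings) auto
  finally show "signed_area p w \<le> int (count_list w A * card (path_rows p w))" .
qed

section \<open>Boundaries of finite sets of cells\<close>

text \<open>The positively oriented boundary, possibly made up of several cycles.\<close>

definition boundary_edges :: "(int \<times> int) set \<Rightarrow> ((int \<times> int) \<times> letter) set" where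
  "boundary_edges S = {e. left_square e \<in> S \<and> right_square e \<notin> S}"

lemma UNIV_letter: "(UNIV :: letter set) = {A, B, A_inv, B_inv}"
  using letter.exhaust by auto

lemma finite_boundary_edges [simp]:
  assumes "finite S"
  shows "finite (boundary_edges S)"
proof (rule inj_on_finite)
  show "inj_on (\<lambda>e. (left_square e, snd e)) (boundary_edges S)"
  proof (rule inj_onI)
    fix e e' :: "(int \<times> int) \<times> letter"
    assume "(left_square e, snd e) = (left_square e', snd e')"
    then show "e = e'" by (cases e; cases e'; cases "snd e") auto
  qed
  show "(\<lambda>e. (left_square e, snd e)) ` boundary_edges S \<subseteq> S \<times> UNIV"
    by (auto simp: boundary_edges_def)
  show "finite (S \<times> (UNIV :: letter set))" using assms by (simp add: UNIV_letter)
qed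

text \<open>In every occupied column the lowest cell provides a lower edge and the highest cell an
  upper edge; rows are similar. Conversely, the left square of an edge lies in the row or column
  that the edge traverses.\<close>

lemma crossing_boundary_edges:
  assumes "finite S"
  shows "crossing ` boundary_edges S = box_crossings (fst ` S) (snd ` S)"
proof
  have "crossing e \<in> box_crossings (fst ` S) (snd ` S)" if "left_square e \<in> S" for e
    using that by (cases e rule: crossing.cases) (force simp: box_crossings_def)+
  then show "crossing ` boundary_edges S \<subseteq> box_crossings (fst ` S) (snd ` S)"
    by (auto simp: boundary_edges_def)
  have "(A, x) \<in> crossing ` boundary_edges S \<and> (A_inv, x) \<in> crossing ` boundary_edges S"
    if "(x, y) \<in> S" for x y
  proof -
    let ?Y = "{y. (x, y) \<in> S}"
    have "?Y \<subseteq> snd ` S" by force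
    with assms have fin: "finite ?Y" by (meson finite_imageI finite_subset)
    have "?Y \<noteq> {}" using that by auto
    note in_Y = Min_in[OF fin this] Max_in[OF fin this]
    have "Min ?Y - 1 \<notin> ?Y" "Max ?Y + 1 \<notin> ?Y"
      using Min_le[OF fin, of "Min ?Y - 1"] Max_ge[OF fin, of "Max ?Y + 1"] by linarith+
    then have "((x, Min ?Y), A) \<in> boundary_edges S"
      "((x + 1, Max ?Y + 1), A_inv) \<in> boundary_edges S"
      using in_Y by (auto simp: boundary_edges_def)
    then show ?thesis by (auto simp: image_iff crossing_eq_iff eq_commute[of "(_, _)" "crossing _"])
  qed
  moreover have "(B, y) \<in> crossing ` boundary_edges S \<and> (B_inv, y) \<in> crossing ` boundary_edges S"
    if "(x, y) \<in> S" for x y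
  proof -
    let ?X = "{x. (x, y) \<in> S}"
    have "?X \<subseteq> fst ` S" by force
    with assms have fin: "finite ?X" by (meson finite_imageI finite_subset)
    have "?X \<noteq> {}" using that by auto
    note in_X = Min_in[OF fin this] Max_in[OF fin this]
    have "Min ?X - 1 \<notin> ?X" "Max ?X + 1 \<notin> ?X"
      using Min_le[OF fin, of "Min ?X - 1"] Max_ge[OF fin, of "Max ?X + 1"] by linarith+
    then have "((Max ?X + 1, y), B) \<in> boundary_edges S"
      "((Min ?X, y + 1), B_inv) \<in> boundary_edges S"
      using in_X by (auto simp: boundary_edges_def)
    then show ?thesis by (auto simp: image_iff crossing_eq_iff eq_commute[of "(_, _)" "crossing _"])
  qed
  ultimately show "box_crossings (fst ` S) (snd ` S) \<subseteq> crossing ` boundary_edges S"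
    by (auto simp: box_crossings_def)
qed

lemma card_boundary_edges_ge:
  assumes "finite S"
  shows "2 * (card (fst ` S) + card (snd ` S)) \<le> card (boundary_edges S)"
  using card_image_le[of "boundary_edges S" crossing] assms
  by (simp add: crossing_boundary_edges card_box_crossings)

lemma card_le_box:
  assumes "finite S"
  shows "card S \<le> card (fst ` S) * card (snd ` S)"
  using card_mono[OF _ subset_fst_snd, of S] assms by (simp add: card_cartesian_product)

text \<open>This identifies two functions with equal jumps along a row or column: their difference
  is constant, and a constant of finite support is zero.\<close>

lemma shift_invariant_finite_support_eq_0:
  fixes f :: "int \<Rightarrow> int"
  assumes shift: "\<And>x. f (x - 1) = f x" and fin: "finite {x. f x \<noteq> 0}"
  shows "f x = 0"
proof -
  have const: "f z = f 0" for z
  proof (induction z rule: int_induct[where k = 0])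
    case (step1 i)
    then show ?case using shift[of "i + 1"] by simp
  qed (use shift in auto)
  have "f 0 = 0"
  proof (rule ccontr)
    assume "f 0 \<noteq> 0"
    then have "f z \<noteq> 0" for z using const[of z] by simp
    then have "{x. f x \<noteq> 0} = UNIV" by simp
    then show False using fin infinite_UNIV_int by simp
  qed
  then show ?thesis using const by simp
qed

lemma int_count_list_distinct:
  assumes "distinct xs"
  shows "int (count_list xs t) = of_bool (t \<in> set xs)"
  using assms by (induction xs) auto

text \<open>Both sides have finite support and the same jumps across the vertical edges of the row.
  Agreement is required in this row alone, so the lemma also applies to a trail that might cover
  only part of the boundary.\<close>

lemma winding_row_eq:
  assumes w: "displacement w = 0" and d: "distinct (path_edges p w)" and S: "finite S"
    and eq: "\<And>e. crossing e \<in> {(B, y), (B_inv, y)} \<Longrightarrow>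
               e \<in> set (path_edges p w) \<longleftrightarrow> e \<in> boundary_edges S"
  shows "winding p w (x, y) = of_bool ((x, y) \<in> S)"
proof -
  define D where "D x = winding p w (x, y) - of_bool ((x, y) \<in> S)" for x
  have "D x = 0"
  proof (rule shift_invariant_finite_support_eq_0[where f = D])
    fix x
    show "D (x - 1) = D x"
      using winding_diff[OF w, of p "((x, y), B)"] eq[of "((x, y), B)"] eq[of "((x, y + 1), B_inv)"]
      unfolding int_count_list_distinct[OF d]
      by (auto simp: boundary_edges_def D_def)
  next
    have "{x. D x \<noteq> 0} \<subseteq> fst ` ({c. winding p w c \<noteq> 0} \<union> S)"
    proof
      fix x assume "x \<in> {x. D x \<noteq> 0}"
      then have "(x, y) \<in> {c. winding p w c \<noteq> 0} \<union> S" by (auto simp: D_def)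
      from imageI[OF this, of fst] show "x \<in> fst ` ({c. winding p w c \<noteq> 0} \<union> S)" by simp
    qed
    then show "finite {x. D x \<noteq> 0}"
      using finite_winding_support[OF w, of p] S by (meson finite_Un finite_imageI finite_subset)
  qed
  then show ?thesis by (simp add: D_def)
qed

lemma winding_column_eq:
  assumes w: "displacement w = 0" and d: "distinct (path_edges p w)" and S: "finite S"
    and eq: "\<And>e. crossing e \<in> {(A, x), (A_inv, x)} \<Longrightarrow>
               e \<in> set (path_edges p w) \<longleftrightarrow> e \<in> boundary_edges S"
  shows "winding p w (x, y) = of_bool ((x, y) \<in> S)"
proof -
  define D where "D y = winding p w (x, y) - of_bool ((x, y) \<in> S)" for y
  have "D y = 0"
  proof (rule shift_invariant_finite_support_eq_0[where f = D])
    fix y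
    show "D (y - 1) = D y"
      using winding_diff[OF w, of p "((x, y), A)"] eq[of "((x, y), A)"] eq[of "((x + 1, y), A_inv)"]
      unfolding int_count_list_distinct[OF d]
      by (auto simp: boundary_edges_def D_def)
  next
    have "{y. D y \<noteq> 0} \<subseteq> snd ` ({c. winding p w c \<noteq> 0} \<union> S)"
    proof
      fix y assume "y \<in> {y. D y \<noteq> 0}"
      then have "(x, y) \<in> {c. winding p w c \<noteq> 0} \<union> S" by (auto simp: D_def)
      from imageI[OF this, of snd] show "y \<in> snd ` ({c. winding p w c \<noteq> 0} \<union> S)" by simp
    qed
    then show "finite {y. D y \<noteq> 0}"
      using finite_winding_support[OF w, of p] S by (meson finite_Un finite_imageI finite_subset)
  qed
  then show ?thesis by (simp add: D_def)
qed

lemma winding_boundary: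
  assumes "displacement w = 0" "distinct (path_edges p w)" "finite S"
    and "set (path_edges p w) = boundary_edges S"
  shows "winding p w c = of_bool (c \<in> S)"
  using winding_row_eq[OF assms(1-3)] assms(4) by (cases c) simp

lemma signed_area_boundary:
  assumes w: "displacement w = 0" and "distinct (path_edges p w)" and S: "finite S"
    and E: "set (path_edges p w) = boundary_edges S"
  shows "signed_area p w = int (card S)"
proof -
  have W: "winding p w c = of_bool (c \<in> S)" for c
    by (rule winding_boundary[OF assms])
  have "S \<subseteq> path_columns p w \<times> path_rows p w"
    using winding_support[OF w, of p] by (force simp: W)
  then show ?thesis
    unfolding signed_area_eq_sum_winding[OF w] W
    by (simp add: sum_of_bool_eq Int_absorb1)
qed

text \<open>
  A closed trail in the boundary meets each row and column of \<open>S\<close> fully or not at all, so that \<open>S\<close>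
  splits into cells in covered rows and columns and cells in uncovered rows and columns.  If both
  parts were present, then \<open>S\<close> would fit into a smaller box.
\<close>

lemma closed_trail_eq_boundary:
  assumes S: "finite S" and inj: "inj_on crossing (boundary_edges S)"
    and min: "\<And>p q. card S \<le> p * q \<Longrightarrow> card (fst ` S) + card (snd ` S) \<le> p + q"
    and w: "displacement w = 0" "w \<noteq> []" and d: "distinct (path_edges p w)"
    and sub: "set (path_edges p w) \<subseteq> boundary_edges S"
  shows "set (path_edges p w) = boundary_edges S"
proof -
  let ?E = "set (path_edges p w)" and ?X = "path_columns p w" and ?Y = "path_rows p w"
  have crossE: "crossing ` ?E = box_crossings ?X ?Y"
    using set_crossings[OF w(1), of p] by simp
  have crossS: "crossing ` boundary_edges S = box_crossings (fst ` S) (snd ` S)"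
    by (rule crossing_boundary_edges[OF S])
  have XY: "?X \<subseteq> fst ` S" "?Y \<subseteq> snd ` S"
    using image_mono[OF sub, of crossing] unfolding crossE crossS
    by (auto simp: box_crossings_def)
  \<comment> \<open>By injectivity of \<open>crossing\<close>, a boundary edge with the same
    crossing as some trail edge is that trail edge.\<close>
  have covered: "e \<in> ?E \<longleftrightarrow> e \<in> boundary_edges S" if c: "crossing e \<in> box_crossings ?X ?Y" for e
  proof
    assume e: "e \<in> boundary_edges S"
    from c obtain e' where "e' \<in> ?E" "crossing e' = crossing e"
      unfolding crossE[symmetric] by auto
    with sub inj e show "e \<in> ?E" by (metis inj_onD subsetD)
  qed (use sub in auto)
  have "winding p w (x, y) = of_bool ((x, y) \<in> S)" if "y \<in> ?Y" for x y
    by (rule winding_row_eq[OF w(1) d S], rule covered) (use that in \<open>auto simp: box_crossings_def\<close>)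
  moreover have "winding p w (x, y) = of_bool ((x, y) \<in> S)" if "x \<in> ?X" for x y
    by (rule winding_column_eq[OF w(1) d S], rule covered) (use that in \<open>auto simp: box_crossings_def\<close>)
  moreover note winding_support[OF w(1), of p]
  \<comment> \<open>In a covered row the winding number is 1 at the cells of \<open>S\<close>, so
    their columns are covered too; symmetrically for columns.\<close>
  ultimately have iff: "x \<in> ?X \<longleftrightarrow> y \<in> ?Y" if "(x, y) \<in> S" for x y
    using that by (metis of_bool_eq_0_iff)
  have "box_crossings ?X ?Y \<noteq> {}" using w(2) crossE by (metis image_is_empty path_edges_eq_Nil_iff set_empty)
  then have ne: "?X \<noteq> {}" "?Y \<noteq> {}"
    using XY iff by (fastforce simp: box_crossings_def)+
  have fin: "finite (fst ` S)" "finite (snd ` S)" using S by auto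
  have X: "?X = fst ` S"
  proof (rule ccontr)
    assume "?X \<noteq> fst ` S"
    with XY have "fst ` S - ?X \<noteq> {}" by auto
    define a b a' b' where "a = card ?X" and "b = card ?Y"
      and "a' = card (fst ` S - ?X)" and "b' = card (snd ` S - ?Y)"
    have pos: "1 \<le> a" "1 \<le> b" "1 \<le> a'"
      using ne \<open>fst ` S - ?X \<noteq> {}\<close> fin
      by (simp_all add: a_def b_def a'_def Suc_le_eq card_gt_0_iff)
    have sum: "card (fst ` S) = a + a'" "card (snd ` S) = b + b'"
      using XY fin by (simp_all add: a_def b_def a'_def b'_def card_Diff_subset card_mono)
    have "S \<subseteq> ?X \<times> ?Y \<union> (fst ` S - ?X) \<times> (snd ` S - ?Y)"
      using iff by force
    then have "card S \<le> card (?X \<times> ?Y \<union> (fst ` S - ?X) \<times> (snd ` S - ?Y))"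
      using fin by (intro card_mono) auto
    also have "\<dots> \<le> a * b + a' * b'"
      using card_Un_le[of "?X \<times> ?Y" "(fst ` S - ?X) \<times> (snd ` S - ?Y)"]
      by (simp add: card_cartesian_product a_def b_def a'_def b'_def)
    \<comment> \<open>Both groups of columns are nonempty, so two boxes in diagonal position leave
      room to spare one whole column, which \<open>min\<close> forbids.\<close>
    also have "\<dots> \<le> (a + a' - 1) * (b + b')"
    proof -
      obtain i j where "a = Suc i" "a' = Suc j" using pos by (metis Suc_le_D One_nat_def)
      then show ?thesis by (simp add: algebra_simps)
    qed
    finally have "a + a' + (b + b') \<le> a + a' - 1 + (b + b')"
      using min sum by metis
    with pos show False by linarith
  qed
  have "?Y = snd ` S" using XY(2) X iff by force
  with X crossE crossS have "crossing ` ?E = crossing ` boundary_edges S" by simp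
  then show ?thesis using sub inj by (meson inj_on_image_eq_iff subset_refl)
qed

section \<open>Closed trails\<close>

text \<open>The Eulerian condition: in-degree equals out-degree at every lattice point.\<close>

definition balanced :: "((int \<times> int) \<times> letter) set \<Rightarrow> bool" where
  "balanced E \<longleftrightarrow> (\<forall>v. (\<Sum>e\<in>E. of_bool (fst e + step (snd e) = v) :: int) =
                           (\<Sum>e\<in>E. of_bool (fst e = v)))"

text \<open>The boundary edges at a lattice point depend only on the four cells around it, and going
  round these cells \<open>S\<close> is entered as often as it is left.\<close>

lemma balanced_boundary_edges:
  assumes "finite S"
  shows "balanced (boundary_edges S)"
  unfolding balanced_def
proof
  fix v
  let ?E = "boundary_edges S" and ?U = "UNIV :: letter set"
  have fin: "finite ?U" by (simp add: UNIV_letter)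
  have out: "(\<Sum>e\<in>?E. of_bool (fst e = v) :: int) = (\<Sum>x\<in>?U. of_bool ((v, x) \<in> ?E))"
  proof -
    have "?E \<inter> {e. fst e = v} = Pair v ` {x. (v, x) \<in> ?E}" by auto
    then show ?thesis
      using assms fin by (simp add: sum_of_bool_eq card_image inj_on_def)
  qed
  have inn: "(\<Sum>e\<in>?E. of_bool (fst e + step (snd e) = v) :: int) =
      (\<Sum>x\<in>?U. of_bool ((v - step x, x) \<in> ?E))"
  proof -
    have "?E \<inter> {e. fst e + step (snd e) = v} = (\<lambda>x. (v - step x, x)) ` {x. (v - step x, x) \<in> ?E}"
      by force
    then show ?thesis
      using assms fin by (simp add: sum_of_bool_eq card_image inj_on_def)
  qed
  obtain x y where v: "v = (x, y)" by (cases v)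
  show "(\<Sum>e\<in>?E. of_bool (fst e + step (snd e) = v) :: int) = (\<Sum>e\<in>?E. of_bool (fst e = v))"
    unfolding out inn by (auto simp: UNIV_letter boundary_edges_def v simp del: sum_of_bool_eq)
qed

lemma ex_closed_trail:
  assumes fin: "finite E" and bal: "balanced E" and e: "(p, x) \<in> E"
  shows "\<exists>w. displacement w = 0 \<and> w \<noteq> [] \<and> distinct (path_edges p w) \<and> set (path_edges p w) \<subseteq> E"
proof -
  let ?T = "\<lambda>w. w \<noteq> [] \<and> distinct (path_edges p w) \<and> set (path_edges p w) \<subseteq> E"
  have "length w \<le> card E" if "?T w" for w
    using that fin by (metis card_mono distinct_card length_path_edges)
  moreover have "?T [x]" using e by simp
  ultimately obtain w where w: "?T w" and max: "\<And>w'. ?T w' \<Longrightarrow> length w' \<le> length w"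
    using ex_has_greatest_nat[of ?T "[x]" length "Suc (card E)"] by (metis le_imp_less_Suc)
  define v where "v = p + displacement w"
  have "v = p"
  proof (rule ccontr)
    assume "v \<noteq> p"
    let ?F = "set (path_edges p w)"
    have "\<exists>e\<in>E - ?F. fst e = v"
    proof (rule ccontr)
      assume no: "\<not> ?thesis"
      \<comment> \<open>Entrances minus exits at \<open>v\<close> telescope to the indicator of the
        end point minus that of the starting point.\<close>
      have "(\<Sum>e\<in>?F. of_bool (fst e + step (snd e) = v) - of_bool (fst e = v)) =
          (\<Sum>e\<leftarrow>path_edges p w. of_bool (fst e + step (snd e) = v) - of_bool (fst e = v) :: int)"
        using w by (simp add: sum_list_distinct_conv_sum_set)
      also have "\<dots> = 1"
        using sum_path_edges_telescope[of _ "\<lambda>u. of_bool (u = v) :: int" p w] \<open>v \<noteq> p\<close>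
        by (simp add: v_def)
      finally have "1 + (\<Sum>e\<in>?F. of_bool (fst e = v) :: int) =
          (\<Sum>e\<in>?F. of_bool (fst e + step (snd e) = v))"
        by (simp add: sum_subtractf)
      also have "\<dots> \<le> (\<Sum>e\<in>E. of_bool (fst e + step (snd e) = v))"
        using w fin by (intro sum_mono2) auto
      also have "\<dots> = (\<Sum>e\<in>E. of_bool (fst e = v))"
        using bal unfolding balanced_def by blast
      also have "\<dots> = (\<Sum>e\<in>?F. of_bool (fst e = v))"
        using w fin no by (intro sum.mono_neutral_right) auto
      finally show False by simp
    qed
    then obtain y where "(v, y) \<in> E - ?F" by (metis prod.collapse)
    then have "?T (w @ [y])" using w by (simp add: v_def)
    from max[OF this] show False by simp
  qed
  with w show ?thesis by (auto simp: v_def)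
qed

text \<open>Where the words first differ, \<open>w\<close> takes the edge chosen by
  \<open>w'\<close> only later, so in between it runs through a closed trail avoiding that edge. By
  \<open>simple\<close> this trail would be all of \<open>E\<close>.\<close>

lemma closed_trail_unique:
  assumes simple: "\<And>p w. displacement w = 0 \<Longrightarrow> w \<noteq> [] \<Longrightarrow> distinct (path_edges p w) \<Longrightarrow>
      set (path_edges p w) \<subseteq> E \<Longrightarrow> set (path_edges p w) = E"
    and d: "distinct (path_edges p w)" "distinct (path_edges p w')"
    and E: "set (path_edges p w) = E" "set (path_edges p w') = E"
  shows "w = w'"
proof (rule ccontr)
  assume "w \<noteq> w'"
  moreover have "length w = length w'"
    using d E by (metis distinct_card length_path_edges)
  ultimately obtain u x r y r' where x: "x \<noteq> y" "w = u @ [x] @ r" "w' = u @ [y] @ r'"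
    using same_length_different by blast
  define v where "v = p + displacement u"
  have "(v, y) \<in> E" "(v, y) \<notin> set (path_edges p u)"
    using d(2) E(2) by (auto simp: x v_def)
  then have "(v, y) \<in> set (path_edges v (x # r))"
    using E(1) by (auto simp: x v_def)
  then obtain z s where z: "x # r = z @ y # s" "v + displacement z = v"
    using path_edges_split[of "(v, y)" v "x # r"] by auto
  have "z \<noteq> []" using z x(1) by auto
  have w: "w = u @ z @ y # s" using z x by simp
  have z0: "displacement z = 0" using z(2) by simp
  have "set (path_edges v z) = E"
    using d(1) E(1) by (intro simple z0 \<open>z \<noteq> []\<close>) (auto simp: w v_def)
  moreover have "(v, y) \<notin> set (path_edges v z)"
    using d(1) z0 by (auto simp: w v_def)
  ultimately show False using \<open>(v, y) \<in> E\<close> by simp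
qed

lemma ex1_boundary_word:
  assumes S: "finite S" and inj: "inj_on crossing (boundary_edges S)"
    and min: "\<And>p q. card S \<le> p * q \<Longrightarrow> card (fst ` S) + card (snd ` S) \<le> p + q"
    and e: "(p, x) \<in> boundary_edges S"
  shows "\<exists>!w. displacement w = 0 \<and> distinct (path_edges p w) \<and>
           set (path_edges p w) = boundary_edges S"
proof -
  note closed = closed_trail_eq_boundary[OF S inj min]
  from ex_closed_trail[OF finite_boundary_edges[OF S] balanced_boundary_edges[OF S] e]
  obtain w where "displacement w = 0" "w \<noteq> []" "distinct (path_edges p w)"
      "set (path_edges p w) \<subseteq> boundary_edges S"
    by blast
  with closed[of w p] have "displacement w = 0" "distinct (path_edges p w)"
      "set (path_edges p w) = boundary_edges S"
    by blast+
  then show ?thesis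
    using closed_trail_unique[of "boundary_edges S"] closed by blast
qed

section \<open>Geodesic words bound minimal sets of cells\<close>

text \<open>If no crossing is repeated, the row holds just one upward and one downward edge, and the
  winding number along it is a difference of two step functions.\<close>

lemma winding_row:
  assumes w: "displacement w = 0" and d: "distinct (crossings p w)" and y: "y \<in> path_rows p w"
  obtains u u' where "((u, y), B) \<in> set (path_edges p w)" "((u', y + 1), B_inv) \<in> set (path_edges p w)"
    "\<And>x. winding p w (x, y) = of_bool (x < u) - of_bool (x < u')"
proof -
  let ?E = "set (path_edges p w)"
  have "{(B, y), (B_inv, y)} \<subseteq> crossing ` ?E"
    using y set_crossings[OF w, of p] by (auto simp: box_crossings_def)
  moreover have inj: "inj_on crossing ?E" using d by (simp add: distinct_map)
  ultimately obtain e e' where e: "e \<in> ?E" "crossing e = (B, y)" and e': "e' \<in> ?E" "crossing e' = (B_inv, y)"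
    by (auto simp: image_iff)
  obtain u u' where u: "e = ((u, y), B)" "e' = ((u', y + 1), B_inv)"
    using e(2) e'(2) by (auto simp: crossing_eq_iff)
  have "winding p w (x, y) = of_bool (x < u) - of_bool (x < u')" for x
  proof -
    have "winding p w (x, y) = (\<Sum>f\<in>?E. ray_right (x, y) f)"
      using d by (simp add: winding_def sum_list_distinct_conv_sum_set distinct_map)
    also have "\<dots> = (\<Sum>f\<in>{e, e'}. ray_right (x, y) f)"
    proof (rule sum.mono_neutral_right)
      show "\<forall>f\<in>?E - {e, e'}. ray_right (x, y) f = 0"
      proof
        fix f assume f: "f \<in> ?E - {e, e'}"
        then have "crossing f \<noteq> (B, y)" "crossing f \<noteq> (B_inv, y)"
          using inj_on_eq_iff[OF inj, of f e] inj_on_eq_iff[OF inj, of f e'] e e' by auto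
        then show "ray_right (x, y) f = 0" by (cases f rule: crossing.cases) auto
      qed
    qed (use e e' in auto)
    finally show ?thesis by (simp add: u)
  qed
  then show thesis by (rule that[OF e(1)[unfolded u] e'(1)[unfolded u]])
qed

lemma winding_column:
  assumes w: "displacement w = 0" and d: "distinct (crossings p w)" and x: "x \<in> path_columns p w"
  obtains v v' where "((x, v), A) \<in> set (path_edges p w)" "((x + 1, v'), A_inv) \<in> set (path_edges p w)"
    "\<And>y. winding p w (x, y) = of_bool (v \<le> y) - of_bool (v' \<le> y)"
proof -
  let ?E = "set (path_edges p w)"
  have "{(A, x), (A_inv, x)} \<subseteq> crossing ` ?E"
    using x set_crossings[OF w, of p] by (auto simp: box_crossings_def)
  moreover have inj: "inj_on crossing ?E" using d by (simp add: distinct_map)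
  ultimately obtain e e' where e: "e \<in> ?E" "crossing e = (A, x)" and e': "e' \<in> ?E" "crossing e' = (A_inv, x)"
    by (auto simp: image_iff)
  obtain v v' where v: "e = ((x, v), A)" "e' = ((x + 1, v'), A_inv)"
    using e(2) e'(2) by (auto simp: crossing_eq_iff)
  have "winding p w (x, y) = of_bool (v \<le> y) - of_bool (v' \<le> y)" for y
  proof -
    have "winding p w (x, y) = (\<Sum>f\<in>?E. ray_down (x, y) f)"
      using d by (simp add: winding_eq_ray_down[OF w] sum_list_distinct_conv_sum_set distinct_map)
    also have "\<dots> = (\<Sum>f\<in>{e, e'}. ray_down (x, y) f)"
    proof (rule sum.mono_neutral_right)
      show "\<forall>f\<in>?E - {e, e'}. ray_down (x, y) f = 0"
      proof
        fix f assume f: "f \<in> ?E - {e, e'}"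
        then have "crossing f \<noteq> (A, x)" "crossing f \<noteq> (A_inv, x)"
          using inj_on_eq_iff[OF inj, of f e] inj_on_eq_iff[OF inj, of f e'] e e' by auto
        then show "ray_down (x, y) f = 0" by (cases f rule: crossing.cases) auto
      qed
    qed (use e e' in auto)
    finally show ?thesis by (simp add: v)
  qed
  then show thesis by (rule that[OF e(1)[unfolded v] e'(1)[unfolded v]])
qed

text \<open>By \<open>min\<close>, every box with room for \<open>k\<close> cells has perimeter at
  least \<open>length w\<close>; the area of \<open>w\<close> is played off against such
  boxes.\<close>

lemma geodesic_boundary:
  assumes w: "displacement w = 0" and k: "signed_area p w = int k" "0 < k"
    and min: "\<And>m n. k \<le> m * n \<Longrightarrow> length w \<le> 2 * (m + n)"
  shows "distinct (path_edges p w)"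
    and "set (path_edges p w) = boundary_edges {c. winding p w c = 1}"
proof -
  let ?E = "set (path_edges p w)" and ?X = "path_columns p w" and ?Y = "path_rows p w"
  let ?W = "winding p w"
  have len: "length w = 2 * (count_list w A + count_list w B)"
    by (rule length_closed_word[OF w])
  \<comment> \<open>The area fits into both boxes with mixed sides, so \<open>min\<close> leaves no
    more \<open>A\<close> steps than visited columns and no more \<open>B\<close> steps than visited
    rows.\<close>
  have "k \<le> card ?X * count_list w B" "k \<le> count_list w A * card ?Y"
    using signed_area_le[OF w, of p] k(1) by (simp_all flip: of_nat_mult)
  from min[OF this(1)] min[OF this(2)] have "count_list w A \<le> card ?X" "count_list w B \<le> card ?Y"
    unfolding len by simp_all
  then have card: "card ?X = count_list w A" "card ?Y = count_list w B"
    by (simp_all add: card_path_columns_le card_path_rows_le le_antisym)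
  \<comment> \<open>The crossings take \<open>2 * (card ?X + card ?Y)\<close> values, which is now
    the length of the word.\<close>
  have d: "distinct (crossings p w)"
    using set_crossings[OF w, of p] card_box_crossings[of ?X ?Y] card len
    by (intro card_distinct) simp
  then show dE: "distinct (path_edges p w)" by (simp add: distinct_map)
  have "int (count_list (crossings p w) t) \<le> 1" for t
    unfolding int_count_list_distinct[OF d] by simp
  then have W_le: "?W (x, y) \<le> 1" for x y
    using winding_le_count(1)[of p w x y] order_trans by blast
  \<comment> \<open>Without winding number 1, row \<open>y\<close> contributes nothing positive, and
    the area would fit into a box with one row less.\<close>
  have row: "\<exists>x. ?W (x, y) = 1" if y: "y \<in> ?Y" for y
  proof (rule ccontr)
    assume no: "\<not> ?thesis"
    have "?W (x, z) \<le> of_bool (z \<noteq> y)" for x z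
      using W_le[of x z] no by (cases "z = y") (auto simp: le_less)
    then have "signed_area p w \<le> (\<Sum>(x, z)\<in>?X \<times> ?Y. of_bool (z \<noteq> y))"
      unfolding signed_area_eq_sum_winding[OF w] by (intro sum_mono) auto
    also have "\<dots> = int (card ?X * (card ?Y - 1))"
      using y by (simp add: sum_of_bool_eq flip: sum.cartesian_product) (simp add: Collect_neg_eq Diff_eq[symmetric])
    finally have "k \<le> card ?X * (card ?Y - 1)" using k(1) by (simp flip: of_nat_mult)
    from min[OF this] y show False
      using len card card_gt_0_iff[of ?Y] by auto
  qed
  have column: "\<exists>y. ?W (x, y) = 1" if x: "x \<in> ?X" for x
  proof (rule ccontr)
    assume no: "\<not> ?thesis"
    have "?W (z, y) \<le> of_bool (z \<noteq> x)" for y z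
      using W_le[of z y] no by (cases "z = x") (auto simp: le_less)
    then have "signed_area p w \<le> (\<Sum>(z, y)\<in>?X \<times> ?Y. of_bool (z \<noteq> x))"
      unfolding signed_area_eq_sum_winding[OF w] by (intro sum_mono) auto
    also have "\<dots> = int ((card ?X - 1) * card ?Y)"
      using x by (simp add: sum_of_bool_eq flip: sum.cartesian_product) (simp add: Collect_neg_eq Diff_eq[symmetric])
    finally have "k \<le> (card ?X - 1) * card ?Y" using k(1) by (simp flip: of_nat_mult)
    from min[OF this] x show False
      using len card card_gt_0_iff[of ?X] by auto
  qed
  \<comment> \<open>In a visited row, a difference of two step functions that takes the value 1
    never takes the value -1; in all other rows the winding number is 0.\<close>
  have W_ge: "0 \<le> ?W (x, y)" for x y
  proof (cases "y \<in> ?Y")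
    case True
    from winding_row[OF w d True] obtain u u'
      where W: "\<And>x. ?W (x, y) = of_bool (x < u) - of_bool (x < u')" by metis
    from row[OF True] obtain z where "?W (z, y) = 1" by blast
    then have "u' < u" unfolding W by (auto simp: of_bool_def split: if_splits)
    then show ?thesis unfolding W by auto
  next
    case False
    then show ?thesis using winding_support(2)[OF w, of p x y] by fastforce
  qed
  have W01: "?W c = 0 \<or> ?W c = 1" for c
    using W_le[of "fst c" "snd c"] W_ge[of "fst c" "snd c"] by (cases c) auto
  have inj: "inj_on crossing ?E" using d by (simp add: distinct_map)
  \<comment> \<open>An edge used in both directions would be both edges of its row or column, and
    the winding number would vanish all along it.\<close>
  have no_flip_AB: "flip_edge e \<notin> ?E" if e: "e \<in> ?E" and AB: "snd e \<in> {A, B}" for e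
  proof
    assume f: "flip_edge e \<in> ?E"
    obtain x y where "e = ((x, y), A) \<or> e = ((x, y), B)" using AB by (cases e) auto
    then show False
    proof
      assume eA: "e = ((x, y), A)"
      with e have x: "x \<in> ?X" by (force simp: path_columns_def)
      from winding_column[OF w d x] obtain v v'
        where v: "((x, v), A) \<in> ?E" "((x + 1, v'), A_inv) \<in> ?E"
          and W: "\<And>y. ?W (x, y) = of_bool (v \<le> y) - of_bool (v' \<le> y)" by metis
      have "v = y" "v' = y"
        using inj_onD[OF inj _ v(1) e] inj_onD[OF inj _ v(2) f] by (simp_all add: eA)
      with column[OF x] W show False by simp
    next
      assume eB: "e = ((x, y), B)"
      with e have y: "y \<in> ?Y" by (force simp: path_rows_def)
      from winding_row[OF w d y] obtain u u'
        where u: "((u, y), B) \<in> ?E" "((u', y + 1), B_inv) \<in> ?E"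
          and W: "\<And>x. ?W (x, y) = of_bool (x < u) - of_bool (x < u')" by metis
      have "u = x" "u' = x"
        using inj_onD[OF inj _ u(1) e] inj_onD[OF inj _ u(2) f] by (simp_all add: eB)
      with row[OF y] W show False by simp
    qed
  qed
  have no_flip: "flip_edge e \<notin> ?E" if e: "e \<in> ?E" for e
  proof (cases "snd e \<in> {A, B}")
    case False
    then have "snd (flip_edge e) \<in> {A, B}" by (cases e; cases "snd e") auto
    then show ?thesis using no_flip_AB[of "flip_edge e"] e by auto
  qed (use no_flip_AB e in blast)
  have diff: "?W (left_square e) - ?W (right_square e) = of_bool (e \<in> ?E) - of_bool (flip_edge e \<in> ?E)" for e
    using winding_diff[OF w, of p e] by (simp add: int_count_list_distinct[OF dE])
  \<comment> \<open>As winding numbers are 0 or 1 and no edge is used in both directions, the edges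
    of the path are exactly those with a jump from 0 on the right to 1 on the left.\<close>
  have "e \<in> ?E \<longleftrightarrow> ?W (left_square e) = 1 \<and> ?W (right_square e) \<noteq> 1" for e
    using diff[of e] no_flip[of e] W01[of "left_square e"] W01[of "right_square e"]
    by (auto simp: of_bool_def split: if_splits)
  then show "?E = boundary_edges {c. ?W c = 1}"
    by (auto simp: boundary_edges_def)
qed

section \<open>Finite unions of unit squares\<close>

abbreviation region :: "(int \<times> int) set \<Rightarrow> (real \<times> real) set" where
  "region S \<equiv> \<Union>c\<in>S. unit_square c"

lemma unit_square_eq_cbox:
  "unit_square c = cbox (lattice_point c) (lattice_point (c + (1, 1)))"
  by (cases c) (auto simp: unit_square_def lattice_point_def cbox_Pair_eq)

lemma interior_unit_square:
  "interior (unit_square (x, y)) = {of_int x<..<of_int x + 1} \<times> {of_int y<..<of_int y + 1}"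
  by (simp add: unit_square_def interior_Times)

lemma closure_interior_unit_square: "closure (interior (unit_square c)) = unit_square c"
  by (cases c) (simp add: interior_unit_square closure_Times, simp add: unit_square_def)

lemma interior_unit_square_Int:
  assumes "interior (unit_square c) \<inter> unit_square c' \<noteq> {}"
  shows "c = c'"
proof -
  obtain x y x' y' where c: "c = (x, y)" "c' = (x', y')" by (cases c, cases c')
  from assms obtain a b :: real where
    "of_int x < a" "a < of_int x + 1" "of_int x' \<le> a" "a \<le> of_int x' + 1"
    "of_int y < b" "b < of_int y + 1" "of_int y' \<le> b" "b \<le> of_int y' + 1"
    unfolding c interior_unit_square by (auto simp: unit_square_def)
  then have "x < x' + 1" "x' < x + 1" "y < y' + 1" "y' < y + 1"
    by linarith+
  then show ?thesis by (simp add: c)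
qed

lemma interior_unit_square_nonempty: "interior (unit_square c) \<noteq> {}"
proof -
  obtain x y where "c = (x, y)" by (cases c)
  then have "(of_int x + 1 / 2, of_int y + 1 / 2) \<in> interior (unit_square c)"
    by (simp add: interior_unit_square)
  then show ?thesis by blast
qed

lemma closed_region: "finite S \<Longrightarrow> closed (region S)"
  by (intro closed_UN) (auto simp: unit_square_eq_cbox)

text \<open>An interior point of a unit square lies in no other unit square, so \<open>S\<close> can
  be recovered from its region.\<close>

lemma unit_square_subset_region [simp]: "unit_square c \<subseteq> region S \<longleftrightarrow> c \<in> S"
proof
  assume sub: "unit_square c \<subseteq> region S"
  obtain z where "z \<in> interior (unit_square c)"
    using interior_unit_square_nonempty by blast
  moreover from this sub obtain c' where "c' \<in> S" "z \<in> unit_square c'"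
    using interior_subset by fastforce
  ultimately show "c \<in> S"
    using interior_unit_square_Int by blast
qed auto

text \<open>Two distinct squares meet in a convex set with empty interior, which is
  negligible.\<close>

lemma area_region:
  assumes "finite S"
  shows "area (region S) = real (card S)"
proof -
  have "area (region S) = (\<Sum>c\<in>S. measure lebesgue (unit_square c))"
    unfolding area_def
  proof (rule measure_negligible_finite_Union_image[OF assms])
    show "unit_square c \<in> lmeasurable" for c
      by (simp add: unit_square_eq_cbox)
    show "pairwise (\<lambda>c c'. negligible (unit_square c \<inter> unit_square c')) S"
    proof (rule pairwiseI)
      fix c c' :: "int \<times> int" assume "c \<noteq> c'"
      then have "interior (unit_square c) \<inter> interior (unit_square c') = {}"
        using interior_unit_square_Int[of c c'] interior_subset[of "unit_square c'"] by blast
      then have "interior (unit_square c \<inter> unit_square c') = {}"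
        by simp
      moreover have "convex (unit_square c \<inter> unit_square c')"
        by (simp add: unit_square_eq_cbox convex_Int)
      ultimately show "negligible (unit_square c \<inter> unit_square c')"
        by (simp add: negligible_convex_interior)
    qed
  qed
  moreover have "measure lebesgue (unit_square c) = 1" for c
    by (cases c) (simp add: unit_square_eq_cbox lattice_point_def content_Pair)
  ultimately show ?thesis by simp
qed

section \<open>Lattice edges and the topological frontier\<close>

lemma lattice_point_in_unit_square:
  "lattice_point p \<in> unit_square c \<longleftrightarrow> p - c \<in> {0, 1} \<times> {0, 1}"
proof -
  have "of_int x \<le> real_of_int u \<and> real_of_int u \<le> of_int x + 1 \<longleftrightarrow> u - x \<in> {0, 1}" for x u
    by (simp, linarith)
  moreover obtain x y u v where "c = (x, y)" "p = (u, v)" by (cases c, cases p)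
  ultimately show ?thesis
    by (simp add: lattice_point_def unit_square_def) blast
qed

lemma edge_segment_subset_unit_square:
  "edge_segment e \<subseteq> unit_square (left_square e)" "edge_segment e \<subseteq> unit_square (right_square e)"
proof -
  have *: "edge_segment e \<subseteq> unit_square c"
    if "fst e - c \<in> {0, 1} \<times> {0, 1}" "fst e + step (snd e) - c \<in> {0, 1} \<times> {0, 1}" for c
    unfolding edge_segment_def
    using that by (intro closed_segment_subset)
      (simp_all only: lattice_point_in_unit_square, simp add: unit_square_eq_cbox)
  obtain u v l where e: "e = ((u, v), l)" by (cases e) auto
  show "edge_segment e \<subseteq> unit_square (left_square e)"
    by (rule *; cases l) (simp_all add: e zero_prod_def)
  show "edge_segment e \<subseteq> unit_square (right_square e)"
    by (rule *; cases l) (simp_all add: e zero_prod_def)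
qed

text \<open>The interior of the right square misses the region, so the right square, and with it the
  edge, lies in the closure of the complement.\<close>

lemma edge_subset_frontier_aux:
  assumes S: "finite S" and l: "left_square e \<in> S" and r: "right_square e \<notin> S"
  shows "edge_segment e \<subseteq> frontier (region S)"
proof -
  have "interior (unit_square (right_square e)) \<inter> region S = {}"
    using interior_unit_square_Int r by blast
  then have "unit_square (right_square e) \<subseteq> closure (- region S)"
    using closure_interior_unit_square[of "right_square e"]
    by (metis closure_mono disjoint_eq_subset_Compl)
  with edge_segment_subset_unit_square(2)[of e] have "edge_segment e \<subseteq> closure (- region S)"
    by blast
  moreover have "edge_segment e \<subseteq> closure (region S)"
    using edge_segment_subset_unit_square(1)[of e] l closure_subset[of "region S"] by blast
  ultimately show ?thesis by (simp add: frontier_closures)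
qed

text \<open>The midpoint serves as a test point near which only the two adjacent squares matter.
  Inverse directions are reached by flipping the edge.\<close>

lemma edge_midpoint:
  assumes "snd e \<in> {A, B}"
  obtains z where "z \<in> edge_segment e"
    and "z \<in> interior (unit_square (left_square e) \<union> unit_square (right_square e))"
    and "\<And>c. z \<in> unit_square c \<Longrightarrow> c = left_square e \<or> c = right_square e"
proof -
  obtain x y where "e = ((x, y), A) \<or> e = ((x, y), B)" using assms by (cases e) auto
  then show thesis
  proof
    assume e: "e = ((x, y), A)"
    let ?z = "(of_int x + 1 / 2, of_int y) :: real \<times> real"
    let ?U = "{of_int x<..<of_int x + 1} \<times> {of_int y - 1<..<of_int y + 1} :: (real \<times> real) set"
    show thesis
    proof (rule that)
      show "?z \<in> edge_segment e"
        unfolding edge_segment_def in_segment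
        by (rule exI[of _ "1 / 2"]) (simp add: e lattice_point_def field_simps)
      have "?U \<subseteq> unit_square (left_square e) \<union> unit_square (right_square e)"
        by (auto simp: e unit_square_def)
      then show "?z \<in> interior (unit_square (left_square e) \<union> unit_square (right_square e))"
        by (rule interiorI[of ?U, rotated 2]) (simp_all add: open_Times)
      fix c assume "?z \<in> unit_square c"
      moreover obtain u v where c: "c = (u, v)" by (cases c)
      ultimately have "real_of_int u \<le> of_int x + 1 / 2" "real_of_int x + 1 / 2 \<le> of_int u + 1"
        "real_of_int v \<le> of_int y" "real_of_int y \<le> of_int v + 1"
        by (simp_all add: unit_square_def)
      then have "u < x + 1" "x < u + 1" "v \<le> y" "y \<le> v + 1" by linarith+
      then show "c = left_square e \<or> c = right_square e" using c by (auto simp: e)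
    qed
  next
    assume e: "e = ((x, y), B)"
    let ?z = "(of_int x, of_int y + 1 / 2) :: real \<times> real"
    let ?U = "{of_int x - 1<..<of_int x + 1} \<times> {of_int y<..<of_int y + 1} :: (real \<times> real) set"
    show thesis
    proof (rule that)
      show "?z \<in> edge_segment e"
        unfolding edge_segment_def in_segment
        by (rule exI[of _ "1 / 2"]) (simp add: e lattice_point_def field_simps)
      have "?U \<subseteq> unit_square (left_square e) \<union> unit_square (right_square e)"
        by (auto simp: e unit_square_def)
      then show "?z \<in> interior (unit_square (left_square e) \<union> unit_square (right_square e))"
        by (rule interiorI[of ?U, rotated 2]) (simp_all add: open_Times)
      fix c assume "?z \<in> unit_square c"
      moreover obtain u v where c: "c = (u, v)" by (cases c)
      ultimately have "real_of_int v \<le> of_int y + 1 / 2" "real_of_int y + 1 / 2 \<le> of_int v + 1"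
        "real_of_int u \<le> of_int x" "real_of_int x \<le> of_int u + 1"
        by (simp_all add: unit_square_def)
      then have "v < y + 1" "y < v + 1" "u \<le> x" "x \<le> u + 1" by linarith+
      then show "c = left_square e \<or> c = right_square e" using c by (auto simp: e)
    qed
  qed
qed

text \<open>If both adjacent squares belong to \<open>S\<close>, the midpoint is interior; if
  neither does, it lies outside the region. The converse applies
  \<open>edge_subset_frontier_aux\<close> to the edge or its flip.\<close>

lemma edge_subset_frontier_iff:
  assumes S: "finite S"
  shows "edge_segment e \<subseteq> frontier (region S) \<longleftrightarrow> (left_square e \<in> S \<longleftrightarrow> right_square e \<notin> S)"
proof -
  have "left_square e \<in> S \<longleftrightarrow> right_square e \<notin> S"
    if sub: "edge_segment e \<subseteq> frontier (region S)" and AB: "snd e \<in> {A, B}" for e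
  proof -
    from AB obtain z where z: "z \<in> edge_segment e"
      "z \<in> interior (unit_square (left_square e) \<union> unit_square (right_square e))"
      "\<And>c. z \<in> unit_square c \<Longrightarrow> c = left_square e \<or> c = right_square e"
      by (rule edge_midpoint) metis
    have "z \<in> frontier (region S)" using z(1) sub by blast
    then have "z \<in> region S" "z \<notin> interior (region S)"
      using closed_region[OF S] by (auto simp: frontier_def)
    moreover have "z \<in> interior (region S)" if "left_square e \<in> S" "right_square e \<in> S"
      using z(2) that interior_mono[of "unit_square (left_square e) \<union> unit_square (right_square e)" "region S"]
      by blast
    ultimately show ?thesis using z(3) by blast
  qed
  from this[of e] this[of "flip_edge e"]
  moreover have "snd e \<in> {A, B} \<or> snd (flip_edge e) \<in> {A, B}"
    by (cases e; cases "snd e") auto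
  ultimately have "left_square e \<in> S \<longleftrightarrow> right_square e \<notin> S" if "edge_segment e \<subseteq> frontier (region S)"
    using that unfolding edge_segment_flip_edge left_square_flip_edge right_square_flip_edge
    by blast
  moreover have "edge_segment e \<subseteq> frontier (region S)" if "left_square e \<in> S \<longleftrightarrow> right_square e \<notin> S"
    using edge_subset_frontier_aux[OF S, of e] edge_subset_frontier_aux[OF S, of "flip_edge e"] that
    by auto
  ultimately show ?thesis by blast
qed

lemma oriented_boundary_edges_region:
  assumes "finite S"
  shows "oriented_boundary_edges (region S, Positive) = boundary_edges S"
  by (auto simp: edge_subset_frontier_iff[OF assms] boundary_edges_def simp del: UN_I)

lemma lattice_point_eq_iff [simp]: "lattice_point p = lattice_point q \<longleftrightarrow> p = q"
  by (auto simp: lattice_point_def prod_eq_iff)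

lemma edge_segment_eq_iff: "edge_segment e = edge_segment e' \<longleftrightarrow> e' = e \<or> e' = flip_edge e"
proof
  assume "edge_segment e = edge_segment e'"
  moreover obtain p l p' l' where e: "e = (p, l)" "e' = (p', l')" by (cases e, cases e')
  ultimately have "p = p' \<and> p + step l = p' + step l' \<or> p = p' + step l' \<and> p + step l = p'"
    by (simp add: edge_segment_def doubleton_eq_iff)
  then show "e' = e \<or> e' = flip_edge e"
    by (cases l; cases l') (auto simp: e prod_eq_iff)
qed (auto simp: edge_segment_flip_edge)

text \<open>Exactly one of the two directions of a frontier edge has \<open>S\<close> on its
  left.\<close>

lemma perimeter_region:
  assumes "finite S"
  shows "perimeter (region S) = card (boundary_edges S)"
proof -
  have "{s \<in> range edge_segment. s \<subseteq> frontier (region S)} = edge_segment ` boundary_edges S"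
  proof safe
    fix p l assume "edge_segment (p, l) \<subseteq> frontier (region S)"
    then have "(p, l) \<in> boundary_edges S \<or> flip_edge (p, l) \<in> boundary_edges S"
      unfolding edge_subset_frontier_iff[OF assms] boundary_edges_def mem_Collect_eq
        left_square_flip_edge right_square_flip_edge by blast
    then show "edge_segment (p, l) \<in> edge_segment ` boundary_edges S"
      by (metis edge_segment_flip_edge image_eqI)
  next
    fix z e assume "z \<in> edge_segment e" "e \<in> boundary_edges S"
    then show "z \<in> frontier (region S)"
      using edge_subset_frontier_aux[OF assms, of e] by (auto simp: boundary_edges_def)
  qed auto
  moreover have "inj_on edge_segment (boundary_edges S)"
    by (auto simp: inj_on_def edge_segment_eq_iff boundary_edges_def)
  ultimately show ?thesis by (simp add: perimeter_def card_image)
qed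

text \<open>If no boundary edge starts at 0, then, going clockwise around 0, each cell in
  \<open>S\<close> forces the next one into \<open>S\<close>, and a neighbourhood of 0 is
  filled.\<close>

lemma zero_in_frontier_region:
  assumes S: "finite S" and 0: "0 \<in> frontier (region S)"
  shows "\<exists>x. (0, x) \<in> boundary_edges S"
proof (rule ccontr)
  assume "\<not> ?thesis"
  then have none: "(0, A) \<notin> boundary_edges S" "(0, B) \<notin> boundary_edges S"
      "(0, A_inv) \<notin> boundary_edges S" "(0, B_inv) \<notin> boundary_edges S"
    by blast+
  have "0 \<in> region S" and not_int: "0 \<notin> interior (region S)"
    using 0 closed_region[OF S] by (auto simp: frontier_def)
  then obtain c where c: "c \<in> S" "lattice_point 0 \<in> unit_square c"
    by (auto simp: lattice_point_def zero_prod_def)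
  then have "c \<in> {(0, 0), (-1, 0), (0, -1), (-1, -1)}"
    by (cases c) (auto simp: lattice_point_in_unit_square)
  with c none have all: "(0, 0) \<in> S" "(-1, 0) \<in> S" "(0, -1) \<in> S" "(-1, -1) \<in> S"
    by (auto simp: boundary_edges_def zero_prod_def)
  have "{-1<..<1} \<times> {-1<..<1} \<subseteq> region S"
  proof safe
    fix a b :: real assume "a \<in> {-1<..<1}" "b \<in> {-1<..<1}"
    then have "(a, b) \<in> unit_square (0, 0) \<union> unit_square (-1, 0) \<union> unit_square (0, -1) \<union>
        unit_square (-1, -1)"
      by (auto simp: unit_square_def)
    then show "(a, b) \<in> region S" using all by blast
  qed
  then have "0 \<in> interior (region S)"
    by (rule interiorI[rotated 2]) (simp_all add: open_Times zero_prod_def)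
  with not_int show False by simp
qed

section \<open>Connectedness of a region bounded by a single path\<close>

lemma connected_path_image:
  "connected (insert (lattice_point p) (\<Union>e\<in>set (path_edges p w). edge_segment e))"
proof (induction w arbitrary: p)
  case (Cons x w)
  let ?K = "insert (lattice_point (p + step x)) (\<Union>e\<in>set (path_edges (p + step x) w). edge_segment e)"
  have "connected (edge_segment (p, x) \<union> ?K)"
    by (rule connected_Un[OF _ Cons.IH]) (auto simp: edge_segment_def)
  moreover have "edge_segment (p, x) \<union> ?K =
      insert (lattice_point p) (\<Union>e\<in>set (path_edges p (x # w)). edge_segment e)"
    by (auto simp: edge_segment_def)
  ultimately show ?case by simp
qed simp

text \<open>The boundary is connected as the image of one path, and every cell is linked to it by
  moving left in its row until a boundary edge is met.\<close>

lemma connected_region: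
  assumes S: "finite S" and E: "set (path_edges p w) = boundary_edges S" and w: "w \<noteq> []"
  shows "connected (region S)"
proof -
  define K where "K = (\<Union>e\<in>boundary_edges S. edge_segment e)"
  obtain x v where xv: "w = x # v" using w by (cases w) auto
  then have "lattice_point p \<in> edge_segment (p, x)" "(p, x) \<in> boundary_edges S"
    by (auto simp: edge_segment_def simp flip: E)
  then have p: "lattice_point p \<in> K" by (auto simp: K_def)
  then have K: "connected K"
    using connected_path_image[of p w] by (simp add: E insert_absorb flip: K_def)
  have K_sub: "K \<subseteq> region S"
    using edge_segment_subset_unit_square(1) by (force simp: K_def boundary_edges_def)
  \<comment> \<open>A lower bound for the columns of \<open>S\<close>, so that \<open>x - m\<close>
    decreases as a measure when moving left.\<close>
  obtain m where m: "\<And>x y. (x, y) \<in> S \<Longrightarrow> m \<le> x"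
    using S by (metis (no_types, lifting) Min_le finite_imageI fst_conv imageI)
  have reach: "\<exists>C. connected C \<and> C \<subseteq> region S \<and> unit_square (x, y) \<subseteq> C \<and> C \<inter> K \<noteq> {}"
    if "(x, y) \<in> S" for x y
    using that
  proof (induction "nat (x - m)" arbitrary: x rule: less_induct)
    case less
    have conn: "connected (unit_square (x, y))"
      by (simp add: unit_square_eq_cbox convex_connected)
    show ?case
    proof (cases "(x - 1, y) \<in> S")
      case True
      from less.hyps[OF _ True] m[OF True] obtain C where C: "connected C" "C \<subseteq> region S"
          "unit_square (x - 1, y) \<subseteq> C" "C \<inter> K \<noteq> {}"
        by auto
      have "lattice_point (x, y) \<in> unit_square (x, y) \<inter> unit_square (x - 1, y)"
        by (simp add: lattice_point_in_unit_square zero_prod_def)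
      then have "connected (unit_square (x, y) \<union> C)"
        using C by (intro connected_Un conn) auto
      then show ?thesis
        using C less.prems by (intro exI[of _ "unit_square (x, y) \<union> C"]) auto
    next
      case False
      \<comment> \<open>The left side of the cell, directed downwards to have the cell on its
        left.\<close>
      let ?e = "((x, y + 1), B_inv)"
      have "?e \<in> boundary_edges S"
        using False less.prems by (simp add: boundary_edges_def)
      then have "edge_segment ?e \<subseteq> K" by (auto simp: K_def)
      moreover have "edge_segment ?e \<subseteq> unit_square (x, y)"
        using edge_segment_subset_unit_square(1)[of ?e] by simp
      moreover have "edge_segment ?e \<noteq> {}" by (simp add: edge_segment_def)
      ultimately show ?thesis
        using conn less.prems by (intro exI[of _ "unit_square (x, y)"]) auto
    qed
  qed
  define F where "F = {C. connected C \<and> C \<subseteq> region S \<and> K \<subseteq> C}"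
  have "connected (\<Union>F)"
    using p by (intro connected_Union) (auto simp: F_def)
  moreover have "\<Union>F = region S"
  proof
    show "region S \<subseteq> \<Union>F"
    proof safe
      fix x y a b assume c: "(x, y) \<in> S" and ab: "(a, b) \<in> unit_square (x, y)"
      from reach[OF c] obtain C where C: "connected C" "C \<subseteq> region S"
          "unit_square (x, y) \<subseteq> C" "C \<inter> K \<noteq> {}"
        by blast
      then have "C \<union> K \<in> F"
        using K_sub K by (auto simp: F_def connected_Un)
      then show "(a, b) \<in> \<Union>F" using C ab by blast
    qed
  qed (auto simp: F_def)
  ultimately show ?thesis by simp
qed

section \<open>Minimal perimeter polyominoes\<close>

lemma polyomino_of_positive_area:
  assumes "polyomino P" "0 < area P"
  obtains S where "finite S" "P = region S"
  using assms by (auto simp: polyomino_def area_def)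

lemma ex_geodesic_representative:
  obtains w where "w \<in> geodesic_representatives (heis_mat 0 0 (int k))"
proof -
  let ?C = "\<lambda>w. displacement w = 0 \<and> signed_area 0 w = int k"
  obtain w where "?C w" using ex_closed_word[of k k 1] by auto
  then obtain w' where "?C w'" "\<And>w. ?C w \<Longrightarrow> length w' \<le> length w"
    using ex_has_least_nat[of ?C w length] by blast
  then show thesis by (intro that[of w']) (auto simp: geodesic_representatives_iff)
qed

lemma length_geodesic_le:
  assumes "w \<in> geodesic_representatives (heis_mat 0 0 (int k))" "k \<le> p * q"
  shows "length w \<le> 2 * (p + q)"
  using assms ex_closed_word[OF assms(2)] by (auto simp: geodesic_representatives_iff)

text \<open>The box spanned by the occupied columns and rows has room for \<open>card S\<close>
  cells, and its perimeter lies between the two sides.\<close>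

lemma length_geodesic_le_card_boundary:
  assumes "w \<in> geodesic_representatives (heis_mat 0 0 (int (card S)))" "finite S"
  shows "length w \<le> card (boundary_edges S)"
  using length_geodesic_le[OF assms(1) card_le_box[OF assms(2)]] card_boundary_edges_ge[OF assms(2)]
  by linarith

lemma reads_region_iff:
  assumes "finite S"
  shows "reads_boundary (region S, Positive) w \<longleftrightarrow> displacement w = 0 \<and>
           distinct (path_edges 0 w) \<and> set (path_edges 0 w) = boundary_edges S"
  unfolding reads_boundary_def oriented_boundary_edges_region[OF assms] ..

text \<open>The polyomino consists of the cells with winding number 1. It is minimal because the
  length of a geodesic bounds the perimeter of every set of \<open>k\<close> cells from
  below.\<close>

lemma geodesic_reads_region:
  assumes w: "w \<in> geodesic_representatives (heis_mat 0 0 (int k))" and k: "0 < k"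
  obtains S where "finite S" "card S = k" "reads_boundary (region S, Positive) w"
    and "minimal_perimeter_polyomino (region S)" "perimeter (region S) = length w"
    and "0 \<in> frontier (region S)"
proof -
  have closed: "displacement w = 0" and area: "signed_area 0 w = int k"
    using w by (auto simp: geodesic_representatives_iff)
  define S where "S = {c. winding 0 w c = 1}"
  note geo = geodesic_boundary[OF closed area k length_geodesic_le[OF w], folded S_def]
  have S: "finite S"
    by (rule finite_subset[OF _ finite_winding_support[OF closed, of 0]]) (auto simp: S_def)
  have card: "card S = k"
    using signed_area_boundary[OF closed geo(1) S geo(2)] area by simp
  have "w \<noteq> []" using area k by (auto simp: signed_area_def)
  have len: "perimeter (region S) = length w"
    using distinct_card[OF geo(1)] by (simp add: perimeter_region[OF S] geo(2))
  have "S \<noteq> {}" using card k by auto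
  then have poly: "polyomino (region S)"
    using connected_region[OF S geo(2) \<open>w \<noteq> []\<close>] S by (auto simp: polyomino_def)
  have min: "minimal_perimeter_polyomino (region S)"
    unfolding minimal_perimeter_polyomino_def
  proof (intro conjI allI impI poly)
    fix Q assume Q: "polyomino Q \<and> area Q = area (region S)"
    then obtain T where T: "finite T" "Q = region T"
      using k by (auto simp: area_region[OF S] card elim: polyomino_of_positive_area)
    then have "card T = k" using Q by (simp add: area_region S card)
    then show "perimeter (region S) \<le> perimeter Q"
      using length_geodesic_le_card_boundary[of w T] w T by (simp add: len perimeter_region)
  qed
  obtain x v where "w = x # v" using \<open>w \<noteq> []\<close> by (cases w) auto
  then have "(0, x) \<in> boundary_edges S" using geo(2) by auto
  then have "edge_segment (0, x) \<subseteq> frontier (region S)"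
    by (simp add: edge_subset_frontier_iff[OF S] boundary_edges_def)
  moreover have "0 \<in> edge_segment (0, x)"
    by (simp add: edge_segment_def lattice_point_def zero_prod_def)
  ultimately show thesis
    using S card min len closed geo
    by (intro that[of S]) (auto simp: reads_region_iff)
qed

text \<open>Comparison with the polyomino of a geodesic \<open>w0\<close> shows that the perimeter
  is \<open>length w0\<close>, which turns the bounds through the spanned box into equalities. So no
  crossing is repeated in the boundary, and no box of smaller perimeter has room for
  \<open>card S\<close> cells.\<close>

lemma minimal_region_reads:
  assumes S: "finite S" "0 < card S" and min: "minimal_perimeter_polyomino (region S)"
    and 0: "0 \<in> frontier (region S)"
  shows "\<exists>!w. reads_boundary (region S, Positive) w"
    and "reads_boundary (region S, Positive) w \<Longrightarrow>
           w \<in> geodesic_representatives (heis_mat 0 0 (int (card S)))"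
proof -
  obtain w0 where w0: "w0 \<in> geodesic_representatives (heis_mat 0 0 (int (card S)))"
    by (rule ex_geodesic_representative)
  obtain T where T: "finite T" "card T = card S" "minimal_perimeter_polyomino (region T)"
      "perimeter (region T) = length w0"
    using geodesic_reads_region[OF w0 S(2)] by metis
  have "perimeter (region S) \<le> perimeter (region T)"
    using min T by (auto simp: minimal_perimeter_polyomino_def area_region S(1))
  then have bdry: "card (boundary_edges S) \<le> length w0"
    using T(4) by (simp add: perimeter_region[OF S(1)])
  then have bdry_eq: "card (boundary_edges S) = length w0"
    using length_geodesic_le_card_boundary[OF w0 S(1)] by simp
  have box: "2 * (card (fst ` S) + card (snd ` S)) \<le> length w0"
    using card_boundary_edges_ge[OF S(1)] bdry by simp
  have "length w0 \<le> 2 * (card (fst ` S) + card (snd ` S))"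
    by (rule length_geodesic_le[OF w0 card_le_box[OF S(1)]])
  with box bdry_eq have "card (crossing ` boundary_edges S) = card (boundary_edges S)"
    using S(1) by (simp add: crossing_boundary_edges card_box_crossings)
  then have inj: "inj_on crossing (boundary_edges S)"
    using S(1) by (intro eq_card_imp_inj_on) auto
  have tight: "card (fst ` S) + card (snd ` S) \<le> p + q" if "card S \<le> p * q" for p q
    using order_trans[OF box length_geodesic_le[OF w0 that]] by simp
  note reads = reads_region_iff[OF S(1)]
  obtain x where "(0, x) \<in> boundary_edges S"
    using zero_in_frontier_region[OF S(1) 0] by blast
  from ex1_boundary_word[OF S(1) inj tight this]
  show "\<exists>!w. reads_boundary (region S, Positive) w"
    unfolding reads .
  assume "reads_boundary (region S, Positive) w"
  then have w: "displacement w = 0" "distinct (path_edges 0 w)"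
      "set (path_edges 0 w) = boundary_edges S"
    unfolding reads by auto
  have "length w = length w0"
    using distinct_card[OF w(2)] w(3) bdry_eq by simp
  then show "w \<in> geodesic_representatives (heis_mat 0 0 (int (card S)))"
    using w0 w(1) signed_area_boundary[OF w(1,2) S(1) w(3)]
    by (simp add: geodesic_representatives_iff)
qed

text \<open>The word determines the winding numbers, and these are the indicator of the enclosed
  cells.\<close>

lemma reads_region_unique:
  assumes "finite S" "finite T"
    and S: "reads_boundary (region S, Positive) w" and T: "reads_boundary (region T, Positive) w"
  shows "S = T"
proof -
  from S T have w: "displacement w = 0" "distinct (path_edges 0 w)"
    "set (path_edges 0 w) = boundary_edges S" "set (path_edges 0 w) = boundary_edges T"
    unfolding reads_region_iff[OF assms(1)] reads_region_iff[OF assms(2)] by auto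
  then have "of_bool (c \<in> S) = (of_bool (c \<in> T) :: int)" for c
    using winding_boundary[OF w(1,2) assms(1) w(3), of c]
      winding_boundary[OF w(1,2) assms(2) w(4), of c] by simp
  then show ?thesis unfolding of_bool_eq_iff by blast
qed

section \<open>The correspondence\<close>

text \<open>A relational form of the bijection, free of the definite description in
  \<open>boundary_word\<close> and easy to transport along reversal.\<close>

definition reading_correspondence :: "int \<Rightarrow> bool" where
  "reading_correspondence k \<longleftrightarrow>
     (\<forall>Q\<in>oriented_minimal_perimeter_polyominoes k.
        (\<exists>!w. reads_boundary Q w) \<and>
        (\<forall>w. reads_boundary Q w \<longrightarrow> w \<in> geodesic_representatives (heis_mat 0 0 k))) \<and>
     (\<forall>w\<in>geodesic_representatives (heis_mat 0 0 k).
        \<exists>!Q. Q \<in> oriented_minimal_perimeter_polyominoes k \<and> reads_boundary Q w)"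

lemma reading_correspondence_pos:
  assumes "0 < k"
  shows "reading_correspondence (int k)"
proof -
  let ?M = "oriented_minimal_perimeter_polyominoes (int k)"
  have Q_iff: "Q \<in> ?M \<longleftrightarrow> (\<exists>S. Q = (region S, Positive) \<and> finite S \<and> card S = k \<and>
      minimal_perimeter_polyomino (region S) \<and> 0 \<in> frontier (region S))" for Q
  proof
    assume "Q \<in> ?M"
    then obtain P where P: "Q = (P, Positive)" "minimal_perimeter_polyomino P" "area P = real k"
        "0 \<in> frontier P"
      by (auto simp: oriented_minimal_perimeter_polyominoes_def)
    moreover from this assms obtain S where "finite S" "P = region S"
      by (auto simp: minimal_perimeter_polyomino_def elim: polyomino_of_positive_area)
    ultimately show "\<exists>S. Q = (region S, Positive) \<and> finite S \<and> card S = k \<and>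
      minimal_perimeter_polyomino (region S) \<and> 0 \<in> frontier (region S)"
      by (auto simp: area_region)
  qed (auto simp: oriented_minimal_perimeter_polyominoes_def area_region)
  show ?thesis
    unfolding reading_correspondence_def
  proof (intro conjI ballI)
    fix Q assume "Q \<in> ?M"
    then show "\<exists>!w. reads_boundary Q w"
      and "\<forall>w. reads_boundary Q w \<longrightarrow> w \<in> geodesic_representatives (heis_mat 0 0 (int k))"
      using minimal_region_reads assms unfolding Q_iff by metis+
  next
    fix w assume "w \<in> geodesic_representatives (heis_mat 0 0 (int k))"
    from geodesic_reads_region[OF this assms] obtain S where
      "(region S, Positive) \<in> ?M" "reads_boundary (region S, Positive) w"
      unfolding Q_iff by metis
    moreover have "Q = Q'" if "Q \<in> ?M" "Q' \<in> ?M" "reads_boundary Q w" "reads_boundary Q' w" for Q Q'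
      using that reads_region_unique unfolding Q_iff by metis
    ultimately show "\<exists>!Q. Q \<in> ?M \<and> reads_boundary Q w" by blast
  qed
qed

text \<open>A nonempty union of squares has positive area, so area 0 leaves only the point at the
  origin. Its frontier contains no edge, which matches the empty word.\<close>

lemma reading_correspondence_0: "reading_correspondence 0"
proof -
  have no_edge: "\<not> edge_segment e \<subseteq> {z}" for e z
  proof
    assume "edge_segment e \<subseteq> {z}"
    moreover have "lattice_point (fst e) \<in> edge_segment e"
      "lattice_point (fst e + step (snd e)) \<in> edge_segment e"
      by (simp_all add: edge_segment_def)
    ultimately have "lattice_point (fst e) = lattice_point (fst e + step (snd e))" by blast
    then show False by (cases "snd e") (auto simp: zero_prod_def)
  qed
  have perimeter: "perimeter {z} = 0" for z
  proof -
    have "{s \<in> range edge_segment. s \<subseteq> {z}} = {}" using no_edge by blast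
    then show ?thesis by (simp add: perimeter_def frontier_def)
  qed
  have "Q \<in> oriented_minimal_perimeter_polyominoes 0 \<longleftrightarrow> Q = ({0}, Positive)" for Q
  proof
    assume "Q \<in> oriented_minimal_perimeter_polyominoes 0"
    then obtain P where P: "Q = (P, Positive)" "polyomino P" "area P = 0" "0 \<in> frontier P"
      by (auto simp: oriented_minimal_perimeter_polyominoes_def minimal_perimeter_polyomino_def)
    then obtain p where "P = {lattice_point p}"
      by (auto simp: polyomino_def area_region)
    with P show "Q = ({0}, Positive)" by (simp add: frontier_def)
  next
    have "polyomino {0}"
      by (auto simp: polyomino_def lattice_point_def zero_prod_def intro!: exI[of _ "(0, 0)"])
    moreover assume "Q = ({0}, Positive)"
    ultimately show "Q \<in> oriented_minimal_perimeter_polyominoes 0"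
      by (auto simp: oriented_minimal_perimeter_polyominoes_def minimal_perimeter_polyomino_def
          perimeter area_def frontier_def)
  qed
  moreover have "reads_boundary ({0}, Positive) w \<longleftrightarrow> w = []" for w
    by (auto simp: reads_boundary_def frontier_def no_edge)
  moreover have "w \<in> geodesic_representatives (heis_mat 0 0 0) \<longleftrightarrow> w = []" for w
  proof
    assume "w \<in> geodesic_representatives (heis_mat 0 0 0)"
    then have "length w \<le> length ([] :: word)"
      unfolding geodesic_representatives_iff by (auto simp: signed_area_def dest: spec[of _ "[]"])
    then show "w = []" by simp
  qed (simp add: geodesic_representatives_iff signed_area_def)
  ultimately show ?thesis unfolding reading_correspondence_def by auto
qed

section \<open>Changing the orientation\<close>

lemma oriented_boundary_edges_Negative:
  "oriented_boundary_edges (P, Negative) = flip_edge ` oriented_boundary_edges (P, Positive)"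
proof -
  have "e \<in> flip_edge ` X \<longleftrightarrow> flip_edge e \<in> X" for e X
    by (metis flip_edge_flip_edge image_iff)
  then show ?thesis by (auto simp del: flip_edge.simps)
qed

text \<open>The reversed word traverses the flipped edges in the opposite order, and flipping
  exchanges the two oriented boundaries.\<close>

lemma reads_boundary_Negative:
  "reads_boundary (P, Negative) w \<longleftrightarrow> reads_boundary (P, Positive) (reverse_word w)"
proof (cases "displacement w = 0")
  case True
  have inv: "flip_edge ` flip_edge ` X = X" for X by (simp add: image_image)
  have "path_edges 0 (reverse_word w) = rev (map flip_edge (path_edges 0 w))"
    using path_edges_reverse_word[of 0 w] True by simp
  moreover have "inj flip_edge" by (metis flip_edge_flip_edge injI)
  then have "distinct (map flip_edge es) \<longleftrightarrow> distinct es" for es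
    by (metis distinct_map inj_on_subset subset_UNIV)
  moreover have "X = flip_edge ` Y \<longleftrightarrow> flip_edge ` X = Y" for X Y
    using inv by metis
  ultimately show ?thesis
    using True by (simp add: reads_boundary_def oriented_boundary_edges_Negative
        del: oriented_boundary_edges.simps)
qed (simp add: reads_boundary_def)

lemma reading_correspondence_neg:
  assumes k: "0 < k" and pos: "reading_correspondence k"
  shows "reading_correspondence (- k)"
proof -
  let ?M = oriented_minimal_perimeter_polyominoes and ?G = "\<lambda>k. geodesic_representatives (heis_mat 0 0 k)"
  \<comment> \<open>Positivity of \<open>k\<close> matters: for area 0 the orientation is positive
    on both sides.\<close>
  have M: "Q \<in> ?M (- k) \<longleftrightarrow> (\<exists>P. Q = (P, Negative) \<and> (P, Positive) \<in> ?M k)" for Q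
    using k by (cases Q; cases "snd Q") (auto simp: oriented_minimal_perimeter_polyominoes_def)
  have Mk: "Q \<in> ?M k \<Longrightarrow> snd Q = Positive" for Q
    using k by (auto simp: oriented_minimal_perimeter_polyominoes_def)
  have G: "reverse_word w \<in> ?G k \<longleftrightarrow> w \<in> ?G (- k)" for w
    by (rule geodesic_representatives_reverse_word)
  show ?thesis
    unfolding reading_correspondence_def
  proof (intro conjI ballI)
    fix Q assume "Q \<in> ?M (- k)"
    then obtain P where Q: "Q = (P, Negative)" and P: "(P, Positive) \<in> ?M k" unfolding M by blast
    from pos P have ex1: "\<exists>!w. reads_boundary (P, Positive) w"
      and geo: "\<And>w. reads_boundary (P, Positive) w \<Longrightarrow> w \<in> ?G k"
      unfolding reading_correspondence_def by blast+
    show "\<exists>!w. reads_boundary Q w"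
      using ex1 unfolding Q reads_boundary_Negative by (metis reverse_word_reverse_word)
    show "\<forall>w. reads_boundary Q w \<longrightarrow> w \<in> ?G (- k)"
      using geo G unfolding Q reads_boundary_Negative by blast
  next
    fix w assume "w \<in> ?G (- k)"
    then have "reverse_word w \<in> ?G k" unfolding G .
    with pos have "\<exists>!Q. Q \<in> ?M k \<and> reads_boundary Q (reverse_word w)"
      unfolding reading_correspondence_def by blast
    then obtain Q where Q: "Q \<in> ?M k" "reads_boundary Q (reverse_word w)"
        and uniq: "\<And>Q'. Q' \<in> ?M k \<Longrightarrow> reads_boundary Q' (reverse_word w) \<Longrightarrow> Q' = Q"
      by blast
    obtain P where P: "Q = (P, Positive)" using Mk[OF Q(1)] by (cases Q) simp
    show "\<exists>!Q. Q \<in> ?M (- k) \<and> reads_boundary Q w"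
    proof (rule ex1I[of _ "(P, Negative)"])
      show "(P, Negative) \<in> ?M (- k) \<and> reads_boundary (P, Negative) w"
        using Q unfolding P M reads_boundary_Negative by blast
    next
      fix Q' assume "Q' \<in> ?M (- k) \<and> reads_boundary Q' w"
      then obtain P' where "Q' = (P', Negative)" "(P', Positive) \<in> ?M k"
          "reads_boundary (P', Positive) (reverse_word w)"
        unfolding M using reads_boundary_Negative by blast
      with uniq[of "(P', Positive)"] show "Q' = (P, Negative)" by (simp add: P)
    qed
  qed
qed

theorem proposition1p6:
  fixes k :: int
  shows "(\<forall>Q \<in> oriented_minimal_perimeter_polyominoes k. \<exists>!w. reads_boundary Q w) \<and>
         bij_betw boundary_word
           (oriented_minimal_perimeter_polyominoes k)
           (geodesic_representatives
              (commutator heisenberg gen_a gen_b [^]\<^bsub>heisenberg\<^esub> k))"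
proof -
  let ?M = "oriented_minimal_perimeter_polyominoes k" and ?G = "geodesic_representatives (heis_mat 0 0 k)"
  have "reading_correspondence k"
  proof (cases k "0 :: int" rule: linorder_cases)
    case less
    then show ?thesis
      using reading_correspondence_neg[of "- k"] reading_correspondence_pos[of "nat (- k)"] by simp
  next
    case greater
    then show ?thesis using reading_correspondence_pos[of "nat k"] by simp
  qed (simp add: reading_correspondence_0)
  then have ex1: "\<And>Q. Q \<in> ?M \<Longrightarrow> \<exists>!w. reads_boundary Q w"
    and geo: "\<And>Q w. Q \<in> ?M \<Longrightarrow> reads_boundary Q w \<Longrightarrow> w \<in> ?G"
    and inv: "\<And>w. w \<in> ?G \<Longrightarrow> \<exists>!Q. Q \<in> ?M \<and> reads_boundary Q w"
    unfolding reading_correspondence_def by blast+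
  have reads: "reads_boundary Q (boundary_word Q)" if "Q \<in> ?M" for Q
    unfolding boundary_word_def using ex1[OF that] by (rule theI')
  have "bij_betw boundary_word ?M ?G"
  proof (rule bij_betwI')
    fix Q Q' assume "Q \<in> ?M" "Q' \<in> ?M"
    \<comment> \<open>The common word is a geodesic read from both polyominoes, so the uniqueness in
      \<open>inv\<close> identifies them.\<close>
    then show "boundary_word Q = boundary_word Q' \<longleftrightarrow> Q = Q'"
      using reads geo inv by metis
  next
    fix Q assume "Q \<in> ?M"
    then show "boundary_word Q \<in> ?G" using reads geo by blast
  next
    fix w assume "w \<in> ?G"
    then show "\<exists>Q\<in>?M. w = boundary_word Q" using inv reads ex1 by metis
  qed
  with ex1 show ?thesis by (simp add: commutator_power)
qed

end
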